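(* Let $(G,\mu)$ be a weighted graph with vertex set $V$, let $p\in[1,\infty)$ and let $1\le k\le\#V-1$ be an integer. For any sequence $\{A_\alpha\}_{\alpha=0}^{k}$ of subsets of $V$ we have $$\nu_{k,p}(G,\mu)^{\frac1p}\le\frac{2}{\mathcal{D}(\{A_\alpha\})}\max_{\alpha=0,\dots,k}\log\frac{e\left(\mu(V)-\sum_{\beta\ne\alpha}\mu(A_\beta)\right)}{\mu(A_\alpha)}.$$
   Context: A weighted graph $(G,\mu)$ consists of a simple connected finite graph $G=(V,E)$ and a nonnegative function $\mu$ on $V\times V$ such that $\mu_{x,y}=\mu_{y,x}$, and $\mu_{x,y}>0$ if and only if $x$ and $y$ form an edge. $V$ carries the graph distance $d$. For $x\in V$ and $\Omega\subset V$ put $\mu(x):=\sum_{y\in V}\mu_{x,y}$ and $\mu(\Omega):=\sum_{x\in\Omega}\mu(x)$. For $\phi:V\to\mathbb{R}$ put $\overline{\phi}:=\frac{1}{\mu(V)}\sum_{x\in V}\phi(x)\mu(x)$. The $k$-th discrete $p$-Poincaré constant is $$\nu_{k,p}(G,\mu):=\inf_{L_k}\sup_{\phi\in L_k\setminus\{0\}}\frac{\sum_{x,y\in V}|\phi(y)-\phi(x)|^p\mu_{x,y}}{2\sum_{x\in V}|\phi(x)-\overline{\phi}|^p\mu(x)},$$ where the infimum is over all $k$-dimensional subspaces $L_k$ of the space $L^p(G,\mu)$ of real functions on $V$ that contain no nonzero constant function. $\mathcal{D}(\{A_\alpha\}):=\min_{\alpha\ne\beta}d(A_\alpha,A_\beta)$,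 with $d(A_\alpha,A_\beta):=\inf\{d(x,y)\mid x\in A_\alpha,\ y\in A_\beta\}$. Convention: if $\mathcal{D}(\{A_\alpha\})=0$ or $\mu(A_\alpha)=0$ for some $\alpha$, the right-hand side is understood as $+\infty$. $\log$ is the natural logarithm. *)

theory Defs
  imports
    "HOL-Analysis.Analysis"
    "Graph_Theory.Digraph_Component"
    "Graph_Theory.Shortest_Path"
begin

text \<open>
  The vertex set \<open>V\<close> is the whole of a finite type \<open>'v\<close>, so that the functions on \<open>V\<close> form the
  real vector space \<open>real ^ 'v\<close>. A \<^locale>\<open>pair_graph\<close> is a finite, symmetric, loop-free digraph
  without multiple arcs, i.e. a finite simple graph, each edge being represented by both of its
  orientations. The name \<open>connected\<close> is qualified because of topological connectedness.
\<close>

locale weighted_graph = pair_graph G for G :: "('v::finite) pair_pre_digraph" +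
  fixes m :: "'v \<Rightarrow> 'v \<Rightarrow> real"
  assumes verts_UNIV: "pverts G = UNIV"
    and connected_graph: "Digraph_Component.connected (with_proj G)"
    and weight_nonneg: "0 \<le> m x y"
    and weight_sym: "m x y = m y x"
    and weight_pos_iff: "0 < m x y \<longleftrightarrow> (x, y) \<in> parcs G"

text \<open>The graph distance is the least number of arcs of a walk: the shortest-path distance
  with unit costs. It is \<open>\<infinity>\<close> if there is no walk.\<close>

definition gdist :: "'v pair_pre_digraph \<Rightarrow> 'v \<Rightarrow> 'v \<Rightarrow> ereal" where
  "gdist G x y = wf_digraph.\<mu> (with_proj G) (\<lambda>_. 1) x y"

definition gsetdist :: "'v pair_pre_digraph \<Rightarrow> 'v set \<Rightarrow> 'v set \<Rightarrow> ereal" where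
  "gsetdist G A B = Inf {gdist G x y | x y. x \<in> A \<and> y \<in> B}"

text \<open>\<open>separation G k A\<close> is \<open>\<D>\<close> of the family \<open>A 0, \<dots>, A k\<close>; it is meaningful for \<open>k \<ge> 1\<close>.\<close>

definition separation :: "'v pair_pre_digraph \<Rightarrow> nat \<Rightarrow> (nat \<Rightarrow> 'v set) \<Rightarrow> ereal" where
  "separation G k A =
     Min {gsetdist G (A \<alpha>) (A \<beta>) | \<alpha> \<beta>. \<alpha> \<le> k \<and> \<beta> \<le> k \<and> \<alpha> \<noteq> \<beta>}"

definition vmeas :: "('v::finite \<Rightarrow> 'v \<Rightarrow> real) \<Rightarrow> 'v \<Rightarrow> real" where
  "vmeas m x = (\<Sum>y\<in>UNIV. m x y)"

definition smeas :: "('v::finite \<Rightarrow> 'v \<Rightarrow> real) \<Rightarrow> 'v set \<Rightarrow> real" where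
  "smeas m A = (\<Sum>x\<in>A. vmeas m x)"

definition wmean :: "('v::finite \<Rightarrow> 'v \<Rightarrow> real) \<Rightarrow> real ^ 'v \<Rightarrow> real" where
  "wmean m \<phi> = 1 / smeas m UNIV * (\<Sum>x\<in>UNIV. \<phi> $ x * vmeas m x)"

definition poincare_quotient :: "real \<Rightarrow> ('v::finite \<Rightarrow> 'v \<Rightarrow> real) \<Rightarrow> real ^ 'v \<Rightarrow> real" where
  "poincare_quotient p m \<phi> =
     (\<Sum>x\<in>UNIV. \<Sum>y\<in>UNIV. \<bar>\<phi> $ y - \<phi> $ x\<bar> powr p * m x y) /
     (2 * (\<Sum>x\<in>UNIV. \<bar>\<phi> $ x - wmean m \<phi>\<bar> powr p * vmeas m x))"

text \<open>
  In a weighted graph with at least two vertices every \<open>vmeas m x\<close> is positive, so the denominator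
  of the quotient vanishes for constant \<open>\<phi>\<close> only, and these are excluded from \<open>L - {0}\<close> below
  (\<open>vec c\<close> is the constant function \<open>c\<close>). The infimum and the supremum are taken in the extended
  reals, where they always exist.
\<close>

definition poincare_const :: "nat \<Rightarrow> real \<Rightarrow> ('v::finite \<Rightarrow> 'v \<Rightarrow> real) \<Rightarrow> ereal" where
  "poincare_const k p m =
     (INF L \<in> {L :: (real ^ 'v) set. subspace L \<and> dim L = k \<and> (\<forall>c. vec c \<in> L \<longrightarrow> c = 0)}.
        SUP \<phi> \<in> L - {0}. ereal (poincare_quotient p m \<phi>))"

text \<open>Real powers with positive exponent on \<open>[0, \<infinity>]\<close>; negative arguments are not intended.\<close>

definition ereal_powr :: "ereal \<Rightarrow> real \<Rightarrow> ereal" where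
  "ereal_powr x a = (if x = \<infinity> then \<infinity> else ereal (real_of_ereal x powr a))"

end

theory Submission
  imports Defs
begin

text \<open>
  Let \<open>D\<close> be the separation and \<open>\<Lambda>\<close> the maximum of the logarithms, so that the claim reads
  \<open>\<nu>\<^sub>k\<^sub>,\<^sub>p \<le> s\<^sup>-\<^sup>p\<close> with \<open>s = D / (2 * \<Lambda>)\<close>. The constant is bounded by testing with linear combinations
  of mean zero of \<open>k + 1\<close> functions \<open>h \<alpha>\<close>, one for each set \<open>A \<alpha>\<close>, with disjoint supports: \<open>h \<alpha>\<close> is \<open>1\<close>
  on some ball \<open>B \<alpha>\<close> around \<open>A \<alpha>\<close> and then falls linearly to \<open>0\<close> before the distance \<open>D / 2\<close>, with a
  slope of at most \<open>1 / s\<close>.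

  Jensen's inequality, applied edge by edge, removes \<open>p\<close> from the problem
  (\<open>poincare_const_le_of_disjoint_family\<close>): it is enough that the total variation of each \<open>h \<alpha>\<close>,
  multiplied by \<open>s\<close>, is at most \<open>2 * \<mu> (B \<alpha>)\<close>.

  It remains to choose the radius of \<open>B \<alpha>\<close>. If the total variation is too large for a radius \<open>t\<close>, then
  the layers between \<open>t\<close> and \<open>t + s\<close> carry many edges. Each edge contributes to the measure of both
  its ends, so the measure of the ball more or less triples when its radius grows by \<open>s\<close>. If no radius works,
  the balls around \<open>A \<alpha>\<close> grow faster than \<open>exp (t / s)\<close>. But the balls of radius less than \<open>D\<close> avoid
  the other sets \<open>A \<beta>\<close>, hence their measure relative to \<open>A \<alpha>\<close> is at most
  \<open>exp (\<Lambda> - 1) = exp (D / (2 * s) - 1)\<close>, a contradiction. Making this precise on a discrete set of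
  layers, without losing in the constant, is the content of \<open>slowly_growing_window\<close>.
\<close>

section \<open>Growth of the measure of layers\<close>

text \<open>
  The layers of a graph around a source set form a one-dimensional discrete object: \<open>c l\<close> is the
  weight of the edges from layer \<open>l\<close> to layer \<open>l + 1\<close>, and \<open>V j\<close> is the measure of the first
  \<open>j + 1\<close> layers. Everything that the distance contributes to the theorem is a statement about two
  such sequences.
\<close>

definition unit_clamp :: "real \<Rightarrow> real" where
  "unit_clamp u = min 1 (max 0 u)"

text \<open>
  For \<open>0 \<le> u \<le> K\<close> this is the integral of \<open>c \<lfloor>v\<rfloor>\<close> over \<open>v \<in> [0, u]\<close>. A piecewise linear cutoff function
  that falls from \<open>1\<close> to \<open>0\<close> between the radii \<open>t\<close> and \<open>t + S\<close> has total variation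
  \<open>2 / S * (cum_cut K c (t + S) - cum_cut K c t)\<close>; this holds for real radii as well, and half-integral
  ones are needed below.
\<close>

definition cum_cut :: "nat \<Rightarrow> (nat \<Rightarrow> real) \<Rightarrow> real \<Rightarrow> real" where
  "cum_cut K c u = (\<Sum>l<K. c l * unit_clamp (u - real l))"

lemma cum_cut_nat:
  assumes "j \<le> K"
  shows "cum_cut K c (real j) = (\<Sum>l<j. c l)"
proof -
  have "cum_cut K c (real j) = (\<Sum>l<K. if l \<in> {..<j} then c l else 0)"
    unfolding cum_cut_def unit_clamp_def by (rule sum.cong) auto
  also have "\<dots> = (\<Sum>l\<in>{..<K} \<inter> {..<j}. c l)"
    by (simp add: sum.inter_restrict)
  also have "{..<K} \<inter> {..<j} = {..<j}" using assms by auto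
  finally show ?thesis .
qed

lemma cum_cut_half:
  assumes "j < K"
  shows "cum_cut K c (real j + 1/2) = (\<Sum>l<j. c l) + c j / 2"
proof -
  have "cum_cut K c (real j + 1/2)
      = (\<Sum>l<K. (if l \<in> {..<j} then c l else 0) + (if l = j then c l / 2 else 0))"
    unfolding cum_cut_def unit_clamp_def by (rule sum.cong) (auto simp: min_def max_def)
  also have "\<dots> = (\<Sum>l\<in>{..<K} \<inter> {..<j}. c l) + c j / 2"
    using assms by (simp add: sum.distrib sum.inter_restrict)
  also have "{..<K} \<inter> {..<j} = {..<j}" using assms by auto
  finally show ?thesis .
qed

text \<open>
  One of the final estimates for half-integral radii needs \<open>e\<^sup>2 < 8\<close>, which the bound \<open>e \<le> 3\<close> does not give.
\<close>

lemma exp_one_less: "exp 1 < (14/5 :: real)"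
proof -
  have "exp (1/16 :: real) \<le> 1 + 1/16 + (1/16)^2"
    by (rule exp_bound) auto
  then have "exp (1/16 :: real) ^ 16 \<le> (1 + 1/16 + (1/16)^2) ^ 16"
    by (rule power_mono) simp
  also have "exp (1/16 :: real) ^ 16 = exp 1"
    by (simp flip: exp_of_nat_mult)
  also have "(1 + 1/16 + (1/16)^2) ^ 16 < (14/5 :: real)"
    by (simp add: power2_eq_square power_divide)
  finally show ?thesis .
qed

lemma exp_le_chord:
  assumes "0 \<le> x" "x \<le> (u::real)" "0 < u"
  shows "exp x \<le> 1 + x / u * (exp u - 1)"
proof -
  have "exp ((1 - x / u) *\<^sub>R 0 + (x / u) *\<^sub>R u) \<le> (1 - x / u) * exp 0 + (x / u) * exp u"
    using assms by (intro convex_onD[OF exp_convex]) auto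
  then show ?thesis using assms by (simp add: algebra_simps)
qed

text \<open>
  With \<open>d = 1 / s\<close> and \<open>x = n / s\<close> this says \<open>z\<^sup>n \<le> 1 + x + x * z\<close> for \<open>z = exp d\<close>: the recursion
  \<open>Y (i + n) = (1 + x) * Y i + x * Y (i + 1)\<close> makes \<open>Y\<close> grow at least as fast as \<open>z ^ i\<close>. The left
  side is convex in \<open>x\<close> and the right side is affine, with equality at \<open>x = 0\<close>, so it is enough to
  look at the other end point \<open>x = 1 + d\<close>.
\<close>

lemma exp_le_shell_growth:
  fixes d :: real
  assumes "0 \<le> d" "d \<le> 1" "0 \<le> x" "x \<le> 1 + d"
  shows "exp x \<le> 1 + x + x * exp d"
proof -
  have "exp d \<le> 1 + d + d\<^sup>2" using assms by (intro exp_bound) auto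
  then have "(14/5 - 1 - d) * exp d \<le> (14/5 - 1 - d) * (1 + d + d\<^sup>2)"
    using assms by (intro mult_left_mono) auto
  also have "\<dots> \<le> 2 + d"
  proof -
    have "0 \<le> d * (d - 2/5)\<^sup>2 + (1/5 + d / 25)" using assms by (intro add_nonneg_nonneg mult_nonneg_nonneg) auto
    also have "\<dots> = 2 + d - (14/5 - 1 - d) * (1 + d + d\<^sup>2)"
      by (simp add: power2_eq_square field_simps)
    finally show ?thesis by simp
  qed
  finally have 1: "14/5 * exp d \<le> 2 + d + (1 + d) * exp d" by (simp add: algebra_simps)
  have "exp (1 + d) \<le> 14/5 * exp d"
    using exp_one_less by (simp add: exp_add)
  with 1 have "exp (1 + d) - 1 \<le> (1 + d) * (1 + exp d)" by (simp add: algebra_simps)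
  then have "x / (1 + d) * (exp (1 + d) - 1) \<le> x / (1 + d) * ((1 + d) * (1 + exp d))"
    using assms by (intro mult_left_mono) auto
  also have "\<dots> = x * (1 + exp d)" using assms by simp
  finally show ?thesis
    using exp_le_chord[of x "1 + d"] assms by (simp add: algebra_simps)
qed


text \<open>
  If a sequence of layers has measure at most \<open>exp (D / (2 * s) - 1)\<close> times that of the source, then
  some window \<open>[t, t + S]\<close> below \<open>D / 2\<close> with \<open>S \<ge> s\<close> carries so little edge weight that the cutoff
  function falling across it has small energy.

  Suppose that every window fails. An edge between two layers is counted in the measure of both, so
  the measure \<open>V i\<close> is at least \<open>Y (i + 1/2)\<close>, where \<open>Y u = V 0 - c 0 + 2 * cum_cut K c u\<close>. Failure of a
  window starting at \<open>t\<close> reads \<open>Y (t + S) > Y t + 2 * (S / s) * V i\<close>, roughly \<open>Y (t + s) > 3 * Y t\<close>. As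
  \<open>3 > e\<close>, the sequence then outgrows \<open>exp (u / s)\<close>, and the loss of a factor \<open>e\<close> in the hypothesis
  pays for the last incomplete step.

  The margin between \<open>e\<close> and \<open>3\<close> is too small to absorb a rounding of \<open>s\<close> in each step when \<open>s\<close> is
  small. The steps therefore have the length \<open>n = \<lceil>s\<rceil>\<close> with the correspondingly larger gain
  \<open>x = n / s\<close>, and the bound \<open>2 * V i \<ge> Y i + Y (i + 1)\<close> is used in place of \<open>2 * V i \<ge> 2 * Y i\<close>. If \<open>D\<close> is odd,
  half a layer is still missing at the end; one window that ends at the half-integer \<open>D / 2\<close>
  supplies it.
\<close>

lemma slowly_growing_window:
  fixes c V :: "nat \<Rightarrow> real" and s :: real
  assumes c_nonneg: "\<And>l. 0 \<le> c l"
    and V0: "0 < V 0" "c 0 \<le> V 0"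
    and shell: "\<And>j. V j + c j + c (Suc j) \<le> V (Suc j)"
    and s: "0 < s" "s \<le> real D / 2"
    and K: "D \<le> K"
    and growth: "\<And>j. j < D \<Longrightarrow> V j \<le> V 0 * exp (real D / (2 * s) - 1)"
  shows "\<exists>t S i. real i \<le> t \<and> s \<le> S \<and> t + S \<le> real D / 2 \<and>
           cum_cut K c (t + S) - cum_cut K c t \<le> S / s * V i"
proof (cases "s \<le> 1")
  case True
  have D: "1 \<le> D" using s by (cases D) auto
  have F0: "cum_cut K c 0 = 0" using cum_cut_nat[of 0 K c] by simp
  show ?thesis
  proof (cases "D = 1")
    case True
    have "cum_cut K c (1/2) = c 0 / 2" using cum_cut_half[of 0 K c] K D by simp
    moreover have "c 0 / 2 \<le> 1/2 / s * V 0"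
    proof -
      have "c 0 * s \<le> V 0 * 1" using c_nonneg V0 s \<open>s \<le> 1\<close> by (intro mult_mono) auto
      then show ?thesis using s by (simp add: field_simps)
    qed
    ultimately show ?thesis
      using F0 s True by (intro exI[of _ 0] exI[of _ "1/2"] exI[of _ 0]) auto
  next
    case False
    have "cum_cut K c 1 = c 0" using cum_cut_nat[of 1 K c] K D by simp
    moreover have "c 0 \<le> 1 / s * V 0"
    proof -
      have "c 0 * s \<le> V 0 * 1" using c_nonneg V0 s \<open>s \<le> 1\<close> by (intro mult_mono) auto
      then show ?thesis using s by (simp add: field_simps)
    qed
    ultimately show ?thesis
      using F0 s False D \<open>s \<le> 1\<close>
      by (intro exI[of _ 0] exI[of _ 1] exI[of _ 0]) auto
  qed
next
  case False
  show ?thesis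
  proof (rule ccontr)
    assume "\<not> ?thesis"
    then have W: "S / s * V i < cum_cut K c (t + S) - cum_cut K c t"
      if "real i \<le> t" "s \<le> S" "t + S \<le> real D / 2" for t S i
      using that by force
    \<comment> \<open>The value of the function \<open>Y\<close> at integers.\<close>
    define Y where "Y j = V 0 - c 0 + 2 * (\<Sum>l<j. c l)" for j
    have Y_Suc: "Y (Suc j) = Y j + 2 * c j" for j by (simp add: Y_def)
    have Y0: "0 \<le> Y 0" using V0 by (simp add: Y_def)
    have Y_mono: "Y i \<le> Y j" if "i \<le> j" for i j
      using that by (induction rule: dec_induct) (use Y_Suc c_nonneg in \<open>auto intro: order_trans\<close>)
    have YV: "Y j + c j \<le> V j" for j
      by (induction j) (use Y_Suc shell in \<open>auto simp: Y_def intro: order_trans\<close>, smt (verit) shell)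
    have YV2: "Y j + Y (Suc j) \<le> 2 * V j" for j
      using YV[of j] Y_Suc[of j] by linarith
    have FY: "2 * cum_cut K c (real j) = Y j - Y 0" if "j \<le> D" for j
      using that K by (simp add: cum_cut_nat Y_def)
    have FYh: "2 * cum_cut K c (real j + 1/2) = (Y j + Y (Suc j)) / 2 - Y 0" if "j < D" for j
      using that K cum_cut_half[of j K c] by (simp add: Y_def field_simps)
    define n where "n = nat \<lceil>s\<rceil>"
    have n: "real n - 1 < s" "s \<le> real n" using s by (auto simp: n_def; linarith)+
    have n2: "2 \<le> n" using n False by linarith
    define x where "x = real n / s"
    define d where "d = 1 / s"
    have d: "0 < d" "d \<le> 1" using s False by (auto simp: d_def)
    have xd: "x = real n * d" by (simp add: x_def d_def)
    have sd: "s * d = 1" using s by (simp add: d_def)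
    have x: "1 \<le> x" "x \<le> 1 + d" "2 * d \<le> x"
    proof -
      show "1 \<le> x" using n s by (simp add: x_def)
      have "real n * d \<le> (s + 1) * d" using n d by (intro mult_right_mono) auto
      then show "x \<le> 1 + d" using sd by (simp add: xd algebra_simps)
      show "2 * d \<le> x" unfolding xd using n2 d by (intro mult_right_mono) auto
    qed
    have rec: "Y i + 2 * x * V i < Y (i + n)" if "2 * (i + n) \<le> D" for i
    proof -
      have "real n / s * V i < cum_cut K c (real i + real n) - cum_cut K c (real i)"
        using that n by (intro W) auto
      then have "x * V i < cum_cut K c (real (i + n)) - cum_cut K c (real i)"
        by (simp add: x_def)
      moreover have "2 * x * V i = 2 * (x * V i)" by simp
      moreover have "2 * cum_cut K c (real i) = Y i - Y 0"
        "2 * cum_cut K c (real (i + n)) = Y (i + n) - Y 0"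
        using FY[of i] FY[of "i + n"] that by (simp_all del: of_nat_add)
      ultimately show ?thesis by linarith
    qed
    \<comment> \<open>The exponent is shifted by \<open>n - 1\<close> so that the bound holds
      trivially for the first \<open>n - 1\<close> indices. Index \<open>0\<close> is excluded,
      because \<open>Y 0\<close> vanishes if all edge weight of the source leaves it.\<close>
    have low: "V 0 * exp ((real j - real n + 1) * d) \<le> Y j" if "1 \<le> j" "2 * j \<le> D" for j
      using that
    proof (induction j rule: less_induct)
      case (less j)
      consider "j < n" | "j = n" | "n < j" by linarith
      then show ?case
      proof cases
        case 1
        have "V 0 * exp ((real j - real n + 1) * d) \<le> V 0 * 1"
          using 1 d V0 by (intro mult_left_mono) (auto simp: mult_le_0_iff)
        also have "\<dots> \<le> Y 1" using c_nonneg[of 0] by (simp add: Y_def)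
        also have "\<dots> \<le> Y j" using less.prems by (intro Y_mono)
        finally show ?thesis .
      next
        case 2
        have "exp d \<le> 2 * x"
        proof -
          have "exp d \<le> 1 + 2 * d"
          proof -
            have "d * (exp 1 - 1) \<le> d * 2" using exp_one_less d by (intro mult_left_mono) auto
            moreover have "exp d \<le> 1 + d * (exp 1 - 1)" using exp_le_chord[of d 1] d by simp
            ultimately show ?thesis by linarith
          qed
          then show ?thesis using x by linarith
        qed
        then have "V 0 * exp d \<le> V 0 * (2 * x)" using V0 by (intro mult_left_mono) auto
        also have "\<dots> \<le> Y j" using rec[of 0] less.prems 2 Y0 by (simp add: algebra_simps)
        finally show ?thesis using 2 by simp
      next
        case 3
        define i where "i = j - n"
        have i: "j = i + n" "1 \<le> i" using 3 by (auto simp: i_def)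
        let ?e = "V 0 * exp ((real i - real n + 1) * d)"
        have "?e * exp x \<le> ?e * (1 + x + x * exp d)"
          using exp_le_shell_growth[of d x] d x V0 by (intro mult_left_mono) auto
        also have "\<dots> = (1 + x) * ?e + x * (V 0 * exp ((real (Suc i) - real n + 1) * d))"
          by (simp add: algebra_simps flip: exp_add)
        also have "\<dots> \<le> (1 + x) * Y i + x * Y (Suc i)"
          using less.IH[of i] less.IH[of "Suc i"] i n2 less.prems x
          by (intro add_mono mult_left_mono) auto
        also have "\<dots> = Y i + x * (Y i + Y (Suc i))" by (simp add: algebra_simps)
        also have "\<dots> \<le> Y i + x * (2 * V i)"
          using YV2[of i] x by (intro add_left_mono mult_left_mono) auto
        also have "\<dots> \<le> Y j" using rec[of i] i less.prems by (simp add: algebra_simps)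
        also have "?e * exp x = V 0 * exp ((real j - real n + 1) * d)"
          by (simp add: xd i algebra_simps flip: exp_add)
        finally show ?thesis .
      qed
    qed
    have target: "V j \<le> V 0 * exp ((real D / 2 - s) * d)" if "j < D" for j
      using growth[OF that] s by (simp add: d_def field_simps)
    define N where "N = D div 2"
    have N1: "1 \<le> N" using s False by (simp add: N_def)
    consider "D = 2 * N" | "D = 2 * N + 1" unfolding N_def by linarith
    then show False
    proof cases
      case 1
      \<comment> \<open>Here \<open>D / 2 = N\<close>, and \<open>n < s + 1\<close> puts the
        exponent of \<open>low\<close> above the allowed one.\<close>
      have "V 0 * exp ((real D / 2 - s) * d) < V 0 * exp ((real N - real n + 1) * d)"
        using V0 1 n d by auto
      also have "\<dots> \<le> Y N" using low N1 1 by simp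
      also have "\<dots> \<le> V N" using YV[of N] c_nonneg[of N] by linarith
      finally show False using target[of N] 1 N1 by simp
    next
      case 2
      have half: "real D / 2 = real N + 1/2" using 2 by simp
      let ?Yh = "(Y N + Y (Suc N)) / 2"
      have "?Yh \<le> Y (Suc N)" using Y_mono[of N "Suc N"] by simp
      also have "\<dots> \<le> V (Suc N)" using YV[of "Suc N"] c_nonneg[of "Suc N"] by linarith
      also have "\<dots> \<le> V 0 * exp ((real N + 1/2 - s) * d)"
        using target[of "Suc N", unfolded half] 2 N1 by simp
      finally have upper: "?Yh \<le> V 0 * exp ((real N + 1/2 - s) * d)" .
      have nN: "n \<le> Suc N" using s n half by linarith
      have exp2: "exp (u + s * d) \<le> 14/5 * exp u" for u
        using exp_one_less by (simp add: exp_add sd)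
      show False
      proof (cases "s \<le> real n - 1/2")
        case True
        define i where "i = Suc N - n"
        have i: "real i = real N + 1 - real n" using nN by (simp add: i_def)
        \<comment> \<open>A window of length \<open>n - 1/2\<close>, which is still at least
          \<open>s\<close>, from an integer up to \<open>N + 1/2\<close>.\<close>
        have "(real n - 1/2) / s * V i < cum_cut K c (real i + (real n - 1/2)) - cum_cut K c (real i)"
          using True half i by (intro W) auto
        also have "real i + (real n - 1/2) = real N + 1/2" using i by simp
        finally have "(real n - 1/2) / s * V i < cum_cut K c (real N + 1/2) - cum_cut K c (real i)" .
        moreover have "2 * cum_cut K c (real i) = Y i - Y 0"
          using 2 n2 by (intro FY) (simp add: i_def)
        moreover have "2 * cum_cut K c (real N + 1/2) = ?Yh - Y 0" using 2 by (intro FYh) simp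
        ultimately have "2 * ((real n - 1/2) / s * V i) < ?Yh - Y i" by linarith
        moreover have "V i \<le> (real n - 1/2) / s * V i"
        proof -
          have "0 \<le> V i" using YV[of i] Y_mono[of 0 i] Y0 c_nonneg[of i] by simp
          then show ?thesis using True s mult_right_mono[of 1 "(real n - 1/2) / s" "V i"] by simp
        qed
        ultimately have Yh: "Y i + 2 * V i < ?Yh" by linarith
        show False
        proof (cases "i = 0")
          case True
          have "V 0 * exp ((real N + 1/2 - s) * d) \<le> V 0 * exp (1/2)"
          proof -
            have "(real N + 1/2 - s) * d \<le> 1/2 * 1"
              using i True n n2 d by (intro mult_mono) auto
            then show ?thesis using V0 by simp
          qed
          also have "exp (1/2) \<le> (2::real)"
            using exp_bound[of "1/2"] by (simp add: power2_eq_square)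
          then have "V 0 * exp (1/2) \<le> V 0 * 2" using V0 by (intro mult_left_mono) auto
          also have "\<dots> \<le> Y 0 + 2 * V 0" using Y0 by simp
          finally show False using upper Yh unfolding True by linarith
        next
          case False
          define u where "u = exp (d / 2)"
          have u2: "exp d = u\<^sup>2" by (simp add: u_def power2_eq_square flip: exp_add)
          let ?e = "V 0 * exp ((real i - real n + 1) * d)"
          have "V 0 * exp ((real N + 1/2 - s) * d) \<le> ?e * exp (d / 2 + s * d)"
          proof -
            have "(real N + 1/2 - s) * d \<le> ((real i - real n + 1) + 1/2 + s) * d"
              using n d i by (intro mult_right_mono) auto
            then show ?thesis using V0 by (simp add: algebra_simps flip: exp_add)
          qed
          also have "\<dots> \<le> ?e * (14/5 * u)"
            unfolding u_def using V0 exp2 by (intro mult_left_mono) auto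
          also have "\<dots> \<le> ?e * (2 + exp d)"
          proof (intro mult_left_mono)
            have "0 \<le> (u - 7/5)\<^sup>2" by simp
            then show "14/5 * u \<le> 2 + exp d"
              unfolding u2 by (simp add: power2_eq_square algebra_simps)
          qed (use V0 in auto)
          also have "\<dots> = 2 * ?e + V 0 * exp ((real (Suc i) - real n + 1) * d)"
            by (simp add: algebra_simps flip: exp_add)
          also have "\<dots> \<le> 2 * Y i + Y (Suc i)"
            using False 2 n2 by (intro add_mono mult_left_mono low) (auto simp: i_def)
          also have "\<dots> \<le> Y i + 2 * V i" using YV2[of i] by linarith
          finally show False using upper Yh by linarith
        qed
      next
        case False
        have "n \<le> N" using False s half n by linarith
        define i where "i = N - n"
        have i: "real i = real N - real n" using \<open>n \<le> N\<close> by (simp add: i_def)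
        \<comment> \<open>A window of length \<open>n\<close> from a half-integer up to \<open>N
          + 1/2\<close>.\<close>
        have "real n / s * V i < cum_cut K c ((real i + 1/2) + real n) - cum_cut K c (real i + 1/2)"
          using n half i by (intro W) auto
        also have "(real i + 1/2) + real n = real N + 1/2" using i by simp
        finally have "x * V i < cum_cut K c (real N + 1/2) - cum_cut K c (real i + 1/2)"
          by (simp add: x_def)
        moreover have "2 * cum_cut K c (real i + 1/2) = (Y i + Y (Suc i)) / 2 - Y 0"
          using 2 n2 by (intro FYh) (simp add: i_def)
        moreover have "2 * cum_cut K c (real N + 1/2) = ?Yh - Y 0" using 2 by (intro FYh) simp
        ultimately have "2 * (x * V i) < ?Yh - (Y i + Y (Suc i)) / 2" by linarith
        moreover have "V i \<le> x * V i"
        proof -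
          have "0 \<le> V i" using YV[of i] Y_mono[of 0 i] Y0 c_nonneg[of i] by simp
          then show ?thesis using x mult_right_mono[of 1 x "V i"] by simp
        qed
        ultimately have Yh: "(Y i + Y (Suc i)) / 2 + 2 * V i < ?Yh" by linarith
        show False
        proof (cases "i = 0")
          case True
          have "(real N + 1/2 - s) * d \<le> 1 * 1"
            using i True n False d by (intro mult_mono) auto
          then have "V 0 * exp ((real N + 1/2 - s) * d) \<le> V 0 * exp 1"
            using V0 by simp
          also have "\<dots> \<le> V 0 * 3" using V0 exp_one_less by (intro mult_left_mono) auto
          also have "\<dots> = (Y 0 + Y (Suc 0)) / 2 + 2 * V 0" by (simp add: Y_def)
          finally show False using upper Yh unfolding True by linarith
        next
          case i0: False
          let ?e = "V 0 * exp ((real i - real n + 1) * d)"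
          define u where "u = exp (d / 2)"
          have u2: "exp d = u\<^sup>2" by (simp add: u_def power2_eq_square flip: exp_add)
          have "V 0 * exp ((real N + 1/2 - s) * d) \<le> ?e * exp (d / 2 + s * d)"
          proof -
            have "(real N + 1/2 - s) * d \<le> ((real i - real n + 1) + 1/2 + s) * d"
              using n d i False by (intro mult_right_mono) auto
            then show ?thesis using V0 by (simp add: algebra_simps flip: exp_add)
          qed
          also have "\<dots> \<le> ?e * (14/5 * u)"
            unfolding u_def using V0 exp2 by (intro mult_left_mono) auto
          also have "\<dots> \<le> ?e * (3/2 * (1 + exp d))"
          proof (intro mult_left_mono)
            have "0 \<le> 3/2 * (u - 1)\<^sup>2 + u / 5" by (simp add: u_def)
            then show "14/5 * u \<le> 3/2 * (1 + exp d)"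
              unfolding u2 by (simp add: power2_eq_square algebra_simps)
          qed (use V0 in auto)
          also have "\<dots> = 3/2 * (?e + V 0 * exp ((real (Suc i) - real n + 1) * d))"
            by (simp add: algebra_simps flip: exp_add)
          also have "\<dots> \<le> 3/2 * (Y i + Y (Suc i))"
            using i0 2 n2 \<open>n \<le> N\<close> by (intro add_mono mult_left_mono low) (auto simp: i_def)
          also have "\<dots> \<le> (Y i + Y (Suc i)) / 2 + 2 * V i"
            using YV2[of i] by (simp add: field_simps)
          finally show False using upper Yh by linarith
        qed
      qed
    qed
  qed
qed

section \<open>Cutoff functions with small total variation\<close>

definition shell_cut :: "('v::finite \<Rightarrow> 'v \<Rightarrow> real) \<Rightarrow> ('v \<Rightarrow> nat) \<Rightarrow> nat \<Rightarrow> real" where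
  "shell_cut m \<rho> l = (\<Sum>x\<in>UNIV. \<Sum>y\<in>UNIV. if \<rho> x = l \<and> \<rho> y = Suc l then m x y else 0)"

lemma smeas_eq_if: "smeas m A = (\<Sum>x\<in>UNIV. if x \<in> A then vmeas m x else 0)"
  unfolding smeas_def by (simp flip: sum.inter_restrict)

lemma shell_cut_le_smeas:
  fixes m :: "'v::finite \<Rightarrow> 'v \<Rightarrow> real"
  assumes m_nonneg: "\<And>x y. 0 \<le> m x y"
  shows "shell_cut m \<rho> 0 \<le> smeas m {x. \<rho> x \<le> 0}"
  unfolding shell_cut_def smeas_eq_if vmeas_def
  by (rule sum_mono) (auto intro!: sum_mono simp: m_nonneg)

text \<open>
  An edge weight between two layers is part of the measure of each of them, so layer \<open>Suc j\<close> is at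
  least as heavy as its connections to the layers \<open>j\<close> and \<open>Suc (Suc j)\<close> together.
\<close>

lemma smeas_shell_ge:
  fixes m :: "'v::finite \<Rightarrow> 'v \<Rightarrow> real"
  assumes m_nonneg: "\<And>x y. 0 \<le> m x y" and m_sym: "\<And>x y. m x y = m y x"
  shows "smeas m {x. \<rho> x \<le> j} + shell_cut m \<rho> j + shell_cut m \<rho> (Suc j) \<le> smeas m {x. \<rho> x \<le> Suc j}"
proof -
  have rev: "shell_cut m \<rho> j = (\<Sum>x\<in>UNIV. \<Sum>y\<in>UNIV. if \<rho> x = Suc j \<and> \<rho> y = j then m x y else 0)"
    unfolding shell_cut_def by (subst sum.swap) (auto intro!: sum.cong simp: m_sym)
  have "shell_cut m \<rho> j + shell_cut m \<rho> (Suc j) \<le> smeas m {x. \<rho> x = Suc j}"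
    unfolding rev unfolding shell_cut_def smeas_eq_if vmeas_def sum.distrib[symmetric]
    by (rule sum_mono) (auto intro!: sum_mono simp: m_nonneg simp flip: sum.distrib)
  moreover have "smeas m {x. \<rho> x \<le> Suc j} = smeas m {x. \<rho> x \<le> j} + smeas m {x. \<rho> x = Suc j}"
    unfolding smeas_def by (subst sum.union_disjoint[symmetric]) (auto intro!: sum.cong)
  ultimately show ?thesis by simp
qed

text \<open>
  A coarea formula: since edges join vertices in equal or adjacent layers, a monotone function of
  the layer index changes only along the layer boundaries. The factor \<open>2\<close> comes from the two
  orientations of an edge.
\<close>

lemma sum_abs_diff_eq_shell_sum:
  fixes m :: "'v::finite \<Rightarrow> 'v \<Rightarrow> real" and g :: "nat \<Rightarrow> real"
  assumes m_nonneg: "\<And>x y. 0 \<le> m x y" and m_sym: "\<And>x y. m x y = m y x"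
    and lip: "\<And>x y. 0 < m x y \<Longrightarrow> \<rho> y \<le> Suc (\<rho> x)"
    and g: "\<And>l. g l \<le> g (Suc l)" and K: "\<And>x. \<rho> x < K"
  shows "(\<Sum>x\<in>UNIV. \<Sum>y\<in>UNIV. \<bar>g (\<rho> x) - g (\<rho> y)\<bar> * m x y)
    = 2 * (\<Sum>l<K. shell_cut m \<rho> l * (g (Suc l) - g l))"
proof -
  let ?f = "\<lambda>l x y. (g (Suc l) - g l) * (if \<rho> x = l \<and> \<rho> y = Suc l then m x y else 0)"
  have pw: "\<bar>g (\<rho> x) - g (\<rho> y)\<bar> * m x y = (\<Sum>l<K. ?f l x y) + (\<Sum>l<K. ?f l y x)" for x y
  proof (cases "m x y = 0")
    case True
    then show ?thesis using m_sym[of x y] by (simp add: if_distrib cong: if_cong)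
  next
    case False
    then have mpos: "0 < m x y" "0 < m y x" using m_nonneg[of x y] m_sym[of x y] by auto
    have one: "(\<Sum>l<K. ?f l u v) = (if \<rho> v = Suc (\<rho> u) then (g (\<rho> v) - g (\<rho> u)) * m u v else 0)" for u v
    proof -
      have "(\<Sum>l<K. ?f l u v)
          = (\<Sum>l<K. if l = \<rho> u then (if \<rho> v = Suc (\<rho> u) then (g (\<rho> v) - g (\<rho> u)) * m u v else 0) else 0)"
        by (rule sum.cong) auto
      then show ?thesis using K[of u] by simp
    qed
    have "\<rho> y = \<rho> x \<or> \<rho> y = Suc (\<rho> x) \<or> \<rho> x = Suc (\<rho> y)"
      using lip[OF mpos(1)] lip[OF mpos(2)] by linarith
    then show ?thesis
      unfolding one using g[of "\<rho> x"] g[of "\<rho> y"] m_sym[of x y] by auto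
  qed
  have swap: "(\<Sum>x\<in>UNIV. \<Sum>y\<in>UNIV. \<Sum>l<K. ?f l x y) = (\<Sum>l<K. shell_cut m \<rho> l * (g (Suc l) - g l))"
  proof -
    have "(\<Sum>x\<in>UNIV. \<Sum>y\<in>UNIV. \<Sum>l<K. ?f l x y) = (\<Sum>x\<in>UNIV. \<Sum>l<K. \<Sum>y\<in>UNIV. ?f l x y)"
      by (intro sum.cong refl sum.swap)
    also have "\<dots> = (\<Sum>l<K. \<Sum>x\<in>UNIV. \<Sum>y\<in>UNIV. ?f l x y)" by (rule sum.swap)
    also have "\<dots> = (\<Sum>l<K. shell_cut m \<rho> l * (g (Suc l) - g l))"
      by (simp only: shell_cut_def sum_distrib_left mult.commute)
    finally show ?thesis .
  qed
  have "(\<Sum>x\<in>UNIV. \<Sum>y\<in>UNIV. \<Sum>l<K. ?f l y x) = (\<Sum>x\<in>UNIV. \<Sum>y\<in>UNIV. \<Sum>l<K. ?f l x y)"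
    by (rule sum.swap)
  then show ?thesis by (simp only: pw sum.distrib swap)
qed

text \<open>
  The test function for a single source set \<open>{x. \<rho> x = 0}\<close>, where \<open>\<rho>\<close> plays the role of the distance
  to it. The third property bounds \<open>h\<close> by the distance to the boundary of the support, measured at
  slope \<open>1 / s\<close>; it controls edges that join the supports of functions for different sources.
\<close>

lemma cutoff_function_exists:
  fixes m :: "'v::finite \<Rightarrow> 'v \<Rightarrow> real" and \<rho> :: "'v \<Rightarrow> nat" and s :: real
  assumes m_nonneg: "\<And>x y. 0 \<le> m x y" and m_sym: "\<And>x y. m x y = m y x"
    and lip: "\<And>x y. 0 < m x y \<Longrightarrow> \<rho> y \<le> Suc (\<rho> x)"
    and A: "0 < smeas m {x. \<rho> x = 0}"
    and s: "0 < s" "s \<le> real D / 2"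
    and growth: "\<And>j. j < D \<Longrightarrow>
      smeas m {x. \<rho> x \<le> j} \<le> smeas m {x. \<rho> x = 0} * exp (real D / (2 * s) - 1)"
  shows "\<exists>h B. B \<noteq> {} \<and> (\<forall>x. 0 \<le> h x) \<and> (\<forall>x\<in>B. h x = 1)
    \<and> (\<forall>x. h x \<le> max 0 ((real D / 2 - real (\<rho> x)) / s))
    \<and> (\<forall>x y. 0 < m x y \<longrightarrow> \<bar>h x - h y\<bar> \<le> 1 / s)
    \<and> s * (\<Sum>x\<in>UNIV. \<Sum>y\<in>UNIV. \<bar>h x - h y\<bar> * m x y) \<le> 2 * smeas m B"
proof -
  let ?c = "shell_cut m \<rho>" and ?V = "\<lambda>j. smeas m {x. \<rho> x \<le> j}"
  define K where "K = max D (Suc (Max (range \<rho>)))"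
  have K: "\<rho> x < K" "D \<le> K" for x by (auto simp: K_def less_Suc_eq_le less_max_iff_disj)
  have "\<exists>t S i. real i \<le> t \<and> s \<le> S \<and> t + S \<le> real D / 2 \<and>
           cum_cut K ?c (t + S) - cum_cut K ?c t \<le> S / s * ?V i"
  proof (rule slowly_growing_window)
    show "0 \<le> ?c l" for l unfolding shell_cut_def by (intro sum_nonneg) (auto simp: m_nonneg)
    show "?c 0 \<le> ?V 0" using m_nonneg by (rule shell_cut_le_smeas)
    show "?V j + ?c j + ?c (Suc j) \<le> ?V (Suc j)" for j using m_nonneg m_sym by (rule smeas_shell_ge)
  qed (use A s growth K in simp_all)
  then obtain t S i where win: "real i \<le> t" "s \<le> S" "t + S \<le> real D / 2"
    "cum_cut K ?c (t + S) - cum_cut K ?c t \<le> S / s * ?V i" by blast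
  \<comment> \<open>The amount by which \<open>S * h\<close> has already fallen at layer
    \<open>u\<close>, if the descent takes place on \<open>[t, t + S]\<close>.\<close>
  define g where "g u = min S (max 0 (real u - t))" for u :: nat
  define h where "h x = 1 - g (\<rho> x) / S" for x
  have S: "0 < S" using win s by simp
  have g: "0 \<le> g u" "g u \<le> S" "g u \<le> g (Suc u)" "g (Suc u) \<le> g u + 1" for u
    using S by (auto simp: g_def)
  have h_diff: "\<bar>h x - h y\<bar> = (1 / S) * \<bar>g (\<rho> x) - g (\<rho> y)\<bar>" for x y
  proof -
    have "h x - h y = - ((1 / S) * (g (\<rho> x) - g (\<rho> y)))" by (simp add: h_def diff_divide_distrib)
    then show ?thesis using S by (simp add: abs_mult)
  qed
  have S_le: "1 / S \<le> 1 / s" using win s by (simp add: frac_le)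
  have "g (Suc l) - g l = unit_clamp (t + S - real l) - unit_clamp (t - real l)" for l
    using S by (auto simp: g_def unit_clamp_def min_def max_def)
  then have "(\<Sum>l<K. ?c l * (g (Suc l) - g l)) = cum_cut K ?c (t + S) - cum_cut K ?c t"
    by (simp add: cum_cut_def sum_subtractf right_diff_distrib)
  with sum_abs_diff_eq_shell_sum[of m \<rho> g K] m_nonneg m_sym lip g K
  have "(\<Sum>x\<in>UNIV. \<Sum>y\<in>UNIV. \<bar>g (\<rho> x) - g (\<rho> y)\<bar> * m x y)
      = 2 * (cum_cut K ?c (t + S) - cum_cut K ?c t)" by simp
  then have "s * (\<Sum>x\<in>UNIV. \<Sum>y\<in>UNIV. \<bar>h x - h y\<bar> * m x y)
      = s * ((1 / S) * (2 * (cum_cut K ?c (t + S) - cum_cut K ?c t)))"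
    unfolding h_diff by (simp only: mult.assoc flip: sum_distrib_left)
  also have "\<dots> \<le> s * ((1 / S) * (2 * (S / s * ?V i)))"
    using win s S by (intro mult_left_mono) auto
  also have "\<dots> = 2 * ?V i" using s S by simp
  finally have energy: "s * (\<Sum>x\<in>UNIV. \<Sum>y\<in>UNIV. \<bar>h x - h y\<bar> * m x y) \<le> 2 * ?V i" .
  have "{x. \<rho> x = 0} \<noteq> {}" using A unfolding smeas_def by (metis less_irrefl sum.empty)
  then have ne: "{x. \<rho> x \<le> i} \<noteq> {}" by (metis (mono_tags, lifting) Collect_empty_eq zero_le)
  have height: "h x \<le> max 0 ((real D / 2 - real (\<rho> x)) / s)" for x
  proof (cases "S \<le> real (\<rho> x) - t")
    case True
    then have "h x = 0" using S by (simp add: h_def g_def)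
    then show ?thesis by simp
  next
    case False
    then have "h x \<le> 1 - (real (\<rho> x) - t) / S"
      using S by (auto simp: h_def g_def intro!: divide_right_mono)
    also have "\<dots> = (1 / S) * (t + S - real (\<rho> x))" using S by (simp add: field_simps)
    also have "\<dots> \<le> (1 / s) * (real D / 2 - real (\<rho> x))"
      using False win S_le s S by (intro mult_mono) auto
    finally show ?thesis by simp
  qed
  have slope: "\<bar>h x - h y\<bar> \<le> 1 / s" if "0 < m x y" for x y
  proof -
    have "\<rho> y \<le> Suc (\<rho> x)" "\<rho> x \<le> Suc (\<rho> y)" using lip that m_sym[of x y] by auto
    then have "\<rho> y = \<rho> x \<or> \<rho> y = Suc (\<rho> x) \<or> \<rho> x = Suc (\<rho> y)" by linarith
    then have "\<bar>g (\<rho> x) - g (\<rho> y)\<bar> \<le> 1"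
      using g(3,4)[of "\<rho> x"] g(3,4)[of "\<rho> y"] by auto
    then have "(1 / S) * \<bar>g (\<rho> x) - g (\<rho> y)\<bar> \<le> (1 / S) * 1" using S by (intro mult_left_mono) auto
    then show ?thesis using S_le by (simp add: h_diff)
  qed
  have "h x = 1" if "\<rho> x \<le> i" for x using that win S by (simp add: h_def g_def)
  moreover have "0 \<le> h x" for x using g[of "\<rho> x"] S by (simp add: h_def)
  ultimately show ?thesis
    using ne height slope energy by (intro exI[of _ h] exI[of _ "{x. \<rho> x \<le> i}"]) auto
qed

section \<open>Upper bounds from functions with disjoint supports\<close>

lemma smeas_mono:
  fixes m :: "'v::finite \<Rightarrow> 'v \<Rightarrow> real"
  assumes "\<And>x y. 0 \<le> m x y" and "X \<subseteq> Z"
  shows "smeas m X \<le> smeas m Z"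
  unfolding smeas_def vmeas_def using assms by (intro sum_mono2 sum_nonneg) auto

text \<open>
  Jensen's inequality for weights of total mass at most \<open>1\<close>: missing mass only helps, because
  \<open>w powr p \<le> w\<close> for \<open>0 \<le> w \<le> 1\<close>. The restriction to \<open>J\<close> serves to have positive arguments, where the
  convexity of \<open>powr\<close> is available.
\<close>

lemma powr_sum_le_sum_powr:
  fixes a z :: "'i \<Rightarrow> real"
  assumes "finite I" and a: "\<And>i. i \<in> I \<Longrightarrow> 0 \<le> a i" and sum_le: "sum a I \<le> 1"
    and z: "\<And>i. i \<in> I \<Longrightarrow> 0 \<le> z i" and p: "1 \<le> p"
  shows "(\<Sum>i\<in>I. a i * z i) powr p \<le> (\<Sum>i\<in>I. a i * z i powr p)"
proof -
  define J where "J = {i \<in> I. 0 < a i \<and> 0 < z i}"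
  have J: "finite J" "J \<subseteq> I" using \<open>finite I\<close> by (auto simp: J_def)
  have outside: "a i * z i = 0 \<and> a i * z i powr p = 0" if "i \<in> I - J" for i
    using that a[of i] z[of i] p by (auto simp: J_def less_le)
  have eq: "(\<Sum>i\<in>I. a i * z i) = (\<Sum>i\<in>J. a i * z i)"
    "(\<Sum>i\<in>I. a i * z i powr p) = (\<Sum>i\<in>J. a i * z i powr p)"
    using J \<open>finite I\<close> outside by (auto intro!: sum.mono_neutral_right)
  show ?thesis
  proof (cases "J = {}")
    case True
    then show ?thesis using eq p by simp
  next
    case False
    define w where "w = sum a J"
    have w: "0 < w" "w \<le> 1"
    proof -
      show "0 < w" unfolding w_def using J False by (intro sum_pos) (auto simp: J_def)
      show "w \<le> 1" unfolding w_def using sum_mono2[of I J a] J \<open>finite I\<close> a sum_le by force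
    qed
    have "(\<Sum>i\<in>J. (a i / w) *\<^sub>R z i) powr p \<le> (\<Sum>i\<in>J. (a i / w) * z i powr p)"
    proof (rule convex_on_sum[OF J(1) False powr_convex[OF p]])
      show "(\<Sum>i\<in>J. a i / w) = 1" using w by (simp add: w_def flip: sum_divide_distrib)
    qed (use w in \<open>auto simp: J_def\<close>)
    then have "((\<Sum>i\<in>J. a i * z i) / w) powr p \<le> (\<Sum>i\<in>J. a i * z i powr p) / w"
      by (simp add: sum_divide_distrib)
    then have "w powr p * ((\<Sum>i\<in>J. a i * z i) / w) powr p \<le> w powr 1 * ((\<Sum>i\<in>J. a i * z i powr p) / w)"
      using w p by (intro mult_mono powr_mono') (auto intro!: divide_nonneg_pos sum_nonneg simp: J_def)
    also have "w powr p * ((\<Sum>i\<in>J. a i * z i) / w) powr p = (\<Sum>i\<in>J. a i * z i) powr p"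
      using w by (simp add: J_def sum_nonneg flip: powr_mult)
    also have "w powr 1 * ((\<Sum>i\<in>J. a i * z i powr p) / w) = (\<Sum>i\<in>J. a i * z i powr p)"
      using w by simp
    finally show ?thesis using eq by simp
  qed
qed

text \<open>
  The reduction of an arbitrary exponent \<open>p\<close> to the total variations of the \<open>h \<alpha>\<close>. On an edge the
  numbers \<open>s * \<bar>h \<alpha> x - h \<alpha> y\<bar>\<close> are weights of mass at most \<open>1\<close>, so Jensen's inequality gives
  \<open>\<bar>\<phi> y - \<phi> x\<bar>\<^sup>p \<le> s\<^sup>-\<^sup>p * (\<Sum>\<alpha>. s * \<bar>h \<alpha> x - h \<alpha> y\<bar> * \<bar>c \<alpha>\<bar>\<^sup>p)\<close>, in which \<open>p\<close> no longer acts on the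
  \<open>h \<alpha>\<close>. This also covers edges joining the supports of two different \<open>h \<alpha>\<close>. In the denominator
  only the sets \<open>B \<alpha>\<close>, where \<open>\<phi> = c \<alpha>\<close>, are kept.
\<close>

lemma poincare_quotient_le_of_disjoint_family:
  fixes m :: "'v::finite \<Rightarrow> 'v \<Rightarrow> real" and h :: "nat \<Rightarrow> 'v \<Rightarrow> real" and k :: nat and s p :: real
  assumes m_nonneg: "\<And>x y. 0 \<le> m x y" and p: "1 \<le> p" and s: "0 < s"
    and one: "\<And>\<alpha> x. \<alpha> \<le> k \<Longrightarrow> x \<in> B \<alpha> \<Longrightarrow> h \<alpha> x = 1"
    and disj: "\<And>\<alpha> \<beta> x. \<alpha> \<le> k \<Longrightarrow> \<beta> \<le> k \<Longrightarrow> \<alpha> \<noteq> \<beta> \<Longrightarrow> h \<alpha> x = 0 \<or> h \<beta> x = 0"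
    and slope: "\<And>x y. 0 < m x y \<Longrightarrow> (\<Sum>\<alpha>\<le>k. \<bar>h \<alpha> x - h \<alpha> y\<bar>) \<le> 1 / s"
    and energy: "\<And>\<alpha>. \<alpha> \<le> k \<Longrightarrow>
      s * (\<Sum>x\<in>UNIV. \<Sum>y\<in>UNIV. \<bar>h \<alpha> x - h \<alpha> y\<bar> * m x y) \<le> 2 * smeas m (B \<alpha>)"
    and \<phi>: "\<And>x. \<phi> $ x = (\<Sum>\<alpha>\<le>k. c \<alpha> * h \<alpha> x)" and mean: "wmean m \<phi> = 0"
  shows "poincare_quotient p m \<phi> \<le> (1 / s) powr p"
proof -
  have vm: "0 \<le> vmeas m x" for x unfolding vmeas_def by (rule sum_nonneg) (simp add: m_nonneg)
  have edge: "\<bar>\<phi> $ y - \<phi> $ x\<bar> powr p * m x y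
      \<le> (1 / s) powr p * (\<Sum>\<alpha>\<le>k. \<bar>c \<alpha>\<bar> powr p * (s * (\<bar>h \<alpha> x - h \<alpha> y\<bar> * m x y)))" for x y
  proof (cases "m x y = 0")
    case False
    then have mpos: "0 < m x y" using m_nonneg[of x y] by simp
    have "\<phi> $ y - \<phi> $ x = (\<Sum>\<alpha>\<le>k. c \<alpha> * (h \<alpha> y - h \<alpha> x))"
      by (simp add: \<phi> sum_subtractf right_diff_distrib)
    also have "\<bar>\<dots>\<bar> \<le> (\<Sum>\<alpha>\<le>k. \<bar>c \<alpha> * (h \<alpha> y - h \<alpha> x)\<bar>)" by (rule sum_abs)
    also have "\<dots> = (1 / s) * (\<Sum>\<alpha>\<le>k. (s * \<bar>h \<alpha> x - h \<alpha> y\<bar>) * \<bar>c \<alpha>\<bar>)"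
      using s by (simp add: sum_distrib_left abs_mult abs_minus_commute mult_ac)
    finally have "\<bar>\<phi> $ y - \<phi> $ x\<bar> powr p \<le> ((1 / s) * (\<Sum>\<alpha>\<le>k. (s * \<bar>h \<alpha> x - h \<alpha> y\<bar>) * \<bar>c \<alpha>\<bar>)) powr p"
      using p by (intro powr_mono2) auto
    also have "\<dots> = (1 / s) powr p * (\<Sum>\<alpha>\<le>k. (s * \<bar>h \<alpha> x - h \<alpha> y\<bar>) * \<bar>c \<alpha>\<bar>) powr p"
      by (rule powr_mult)
    also have "\<dots> \<le> (1 / s) powr p * (\<Sum>\<alpha>\<le>k. (s * \<bar>h \<alpha> x - h \<alpha> y\<bar>) * \<bar>c \<alpha>\<bar> powr p)"
    proof (intro mult_left_mono powr_sum_le_sum_powr)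
      show "(\<Sum>\<alpha>\<le>k. s * \<bar>h \<alpha> x - h \<alpha> y\<bar>) \<le> 1"
        using slope[OF mpos] s by (simp add: field_simps flip: sum_distrib_left)
    qed (use s p in auto)
    finally have "\<bar>\<phi> $ y - \<phi> $ x\<bar> powr p * m x y
      \<le> (1 / s) powr p * (\<Sum>\<alpha>\<le>k. (s * \<bar>h \<alpha> x - h \<alpha> y\<bar>) * \<bar>c \<alpha>\<bar> powr p) * m x y"
      using m_nonneg by (rule mult_right_mono)
    also have "\<dots> = (1 / s) powr p * (\<Sum>\<alpha>\<le>k. \<bar>c \<alpha>\<bar> powr p * (s * (\<bar>h \<alpha> x - h \<alpha> y\<bar> * m x y)))"
      by (simp add: sum_distrib_right sum_distrib_left mult_ac)
    finally show ?thesis .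
  qed simp
  define E where "E = (\<Sum>\<alpha>\<le>k. \<bar>c \<alpha>\<bar> powr p * smeas m (B \<alpha>))"
  have num: "(\<Sum>x\<in>UNIV. \<Sum>y\<in>UNIV. \<bar>\<phi> $ y - \<phi> $ x\<bar> powr p * m x y) \<le> (1 / s) powr p * (2 * E)"
  proof -
    let ?f = "\<lambda>\<alpha> x y. \<bar>c \<alpha>\<bar> powr p * (s * (\<bar>h \<alpha> x - h \<alpha> y\<bar> * m x y))"
    have "(\<Sum>x\<in>UNIV. \<Sum>y\<in>UNIV. \<bar>\<phi> $ y - \<phi> $ x\<bar> powr p * m x y)
      \<le> (\<Sum>x\<in>UNIV. \<Sum>y\<in>UNIV. (1 / s) powr p * (\<Sum>\<alpha>\<le>k. \<bar>c \<alpha>\<bar> powr p * (s * (\<bar>h \<alpha> x - h \<alpha> y\<bar> * m x y))))"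
      by (intro sum_mono edge)
    also have "\<dots> = (1 / s) powr p * (\<Sum>x\<in>UNIV. \<Sum>y\<in>UNIV. \<Sum>\<alpha>\<le>k. \<bar>c \<alpha>\<bar> powr p * (s * (\<bar>h \<alpha> x - h \<alpha> y\<bar> * m x y)))"
      by (simp only: sum_distrib_left)
    also have "(\<Sum>x\<in>UNIV. \<Sum>y\<in>UNIV. \<Sum>\<alpha>\<le>k. ?f \<alpha> x y) = (\<Sum>x\<in>UNIV. \<Sum>\<alpha>\<le>k. \<Sum>y\<in>UNIV. ?f \<alpha> x y)"
      by (intro sum.cong refl sum.swap)
    also have "\<dots> = (\<Sum>\<alpha>\<le>k. \<Sum>x\<in>UNIV. \<Sum>y\<in>UNIV. ?f \<alpha> x y)"
      by (rule sum.swap)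
    also have "\<dots> = (\<Sum>\<alpha>\<le>k. \<bar>c \<alpha>\<bar> powr p * (s * (\<Sum>x\<in>UNIV. \<Sum>y\<in>UNIV. \<bar>h \<alpha> x - h \<alpha> y\<bar> * m x y)))"
      by (simp only: sum_distrib_left)
    also have "\<dots> \<le> (\<Sum>\<alpha>\<le>k. \<bar>c \<alpha>\<bar> powr p * (2 * smeas m (B \<alpha>)))"
      by (intro sum_mono mult_left_mono energy) auto
    also have "\<dots> = 2 * E" by (simp add: E_def sum_distrib_left mult_ac)
    finally show ?thesis by (simp add: mult_left_mono)
  qed
  have den: "E \<le> (\<Sum>x\<in>UNIV. \<bar>\<phi> $ x - wmean m \<phi>\<bar> powr p * vmeas m x)"
  proof -
    have \<phi>B: "\<phi> $ x = c \<alpha>" if "\<alpha> \<le> k" "x \<in> B \<alpha>" for \<alpha> x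
    proof -
      have "\<phi> $ x = (\<Sum>\<beta>\<le>k. if \<beta> = \<alpha> then c \<alpha> else 0)"
        unfolding \<phi> by (rule sum.cong) (use that one disj[of _ \<alpha> x] in force)+
      then show ?thesis using that by simp
    qed
    have "E = (\<Sum>\<alpha>\<le>k. \<Sum>x\<in>B \<alpha>. \<bar>\<phi> $ x\<bar> powr p * vmeas m x)"
      unfolding E_def smeas_def sum_distrib_left
      by (intro sum.cong refl) (simp add: \<phi>B)
    also have "\<dots> = (\<Sum>x\<in>(\<Union>\<alpha>\<le>k. B \<alpha>). \<bar>\<phi> $ x\<bar> powr p * vmeas m x)"
    proof (rule sum.UNION_disjoint[symmetric])
      show "\<forall>\<alpha>\<in>{..k}. \<forall>\<beta>\<in>{..k}. \<alpha> \<noteq> \<beta> \<longrightarrow> B \<alpha> \<inter> B \<beta> = {}"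
      proof (intro ballI impI equals0I)
        fix \<alpha> \<beta> x assume "\<alpha> \<in> {..k}" "\<beta> \<in> {..k}" "\<alpha> \<noteq> \<beta>" "x \<in> B \<alpha> \<inter> B \<beta>"
        then show False using disj[of \<alpha> \<beta> x] one[of \<alpha> x] one[of \<beta> x] by auto
      qed
    qed auto
    also have "\<dots> \<le> (\<Sum>x\<in>UNIV. \<bar>\<phi> $ x\<bar> powr p * vmeas m x)"
      by (rule sum_mono2) (auto simp: vm)
    finally show ?thesis using mean by simp
  qed
  let ?N = "\<Sum>x\<in>UNIV. \<Sum>y\<in>UNIV. \<bar>\<phi> $ y - \<phi> $ x\<bar> powr p * m x y"
  let ?D = "\<Sum>x\<in>UNIV. \<bar>\<phi> $ x - wmean m \<phi>\<bar> powr p * vmeas m x"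
  have D0: "0 \<le> ?D" by (intro sum_nonneg mult_nonneg_nonneg vm) auto
  have "?N \<le> (1 / s) powr p * (2 * ?D)"
    using num den by (meson mult_left_mono order_trans powr_ge_zero zero_le_numeral)
  then show ?thesis
    unfolding poincare_quotient_def using D0
    by (cases "?D = 0") (simp_all add: pos_divide_le_eq)
qed

text \<open>
  The space to be tested must have dimension \<open>k\<close> and must not see the mean. The \<open>k + 1\<close> functions
  \<open>h \<alpha>\<close> are linearly independent since their supports are disjoint, so the functions of mean zero in
  their span form a space of dimension at least \<open>k\<close>; such a space contains no nonzero constant.
\<close>

lemma poincare_const_le_of_disjoint_family:
  fixes m :: "'v::finite \<Rightarrow> 'v \<Rightarrow> real" and h :: "nat \<Rightarrow> 'v \<Rightarrow> real" and k :: nat and s p :: real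
  assumes m_nonneg: "\<And>x y. 0 \<le> m x y" and p: "1 \<le> p" and s: "0 < s"
    and total: "0 < smeas m UNIV"
    and ne: "\<And>\<alpha>. \<alpha> \<le> k \<Longrightarrow> B \<alpha> \<noteq> {}"
    and one: "\<And>\<alpha> x. \<alpha> \<le> k \<Longrightarrow> x \<in> B \<alpha> \<Longrightarrow> h \<alpha> x = 1"
    and disj: "\<And>\<alpha> \<beta> x. \<alpha> \<le> k \<Longrightarrow> \<beta> \<le> k \<Longrightarrow> \<alpha> \<noteq> \<beta> \<Longrightarrow> h \<alpha> x = 0 \<or> h \<beta> x = 0"
    and slope: "\<And>x y. 0 < m x y \<Longrightarrow> (\<Sum>\<alpha>\<le>k. \<bar>h \<alpha> x - h \<alpha> y\<bar>) \<le> 1 / s"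
    and energy: "\<And>\<alpha>. \<alpha> \<le> k \<Longrightarrow>
      s * (\<Sum>x\<in>UNIV. \<Sum>y\<in>UNIV. \<bar>h \<alpha> x - h \<alpha> y\<bar> * m x y) \<le> 2 * smeas m (B \<alpha>)"
  shows "poincare_const k p m \<le> ereal ((1 / s) powr p)"
proof -
  define H where "H \<alpha> = (\<chi> x. h \<alpha> x)" for \<alpha>
  define w where "w = (\<chi> x. vmeas m x)"
  have wdot: "w \<bullet> v = (\<Sum>x\<in>UNIV. v $ x * vmeas m x)" for v
    by (simp add: inner_vec_def w_def mult.commute)
  have wvec: "w \<bullet> vec c = c * smeas m UNIV" for c
    by (simp add: wdot smeas_def sum_distrib_left)
  have orth: "H \<alpha> \<bullet> H \<beta> = 0" if "\<alpha> \<le> k" "\<beta> \<le> k" "\<alpha> \<noteq> \<beta>" for \<alpha> \<beta>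
    unfolding inner_vec_def H_def by (rule sum.neutral) (use disj[OF that] in auto)
  have Hn0: "H \<alpha> \<noteq> 0" if "\<alpha> \<le> k" for \<alpha>
    using ne[OF that] one[OF that] by (auto simp: H_def vec_eq_iff)
  have inj: "inj_on H {..k}"
    by (rule inj_onI) (metis atMost_iff Hn0 inner_eq_zero_iff orth)
  have "independent (H ` {..k})"
  proof (rule pairwise_orthogonal_independent)
    show "pairwise orthogonal (H ` {..k})"
      by (auto simp: pairwise_def orthogonal_def intro!: orth)
    show "0 \<notin> H ` {..k}" using Hn0 by force
  qed
  then have dimS: "dim (span (H ` {..k})) = Suc k"
    using inj by (simp add: dim_eq_card_independent card_image)
  have wn0: "w \<noteq> 0" using wvec[of 1] total by auto
  let ?Z = "{v. w \<bullet> v = 0}"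
  have Z: "subspace ?Z" by (rule subspace_hyperplane)
  have "Suc k + (CARD('v) - 1) \<le> CARD('v) + dim (span (H ` {..k}) \<inter> ?Z)"
    using dim_sums_Int[OF subspace_span[of "H ` {..k}"] Z] dim_hyperplane[OF wn0] dimS
      dim_subset_UNIV[of "{x + y |x y. x \<in> span (H ` {..k}) \<and> y \<in> ?Z}"] by simp
  moreover have "1 \<le> CARD('v)" by (simp add: Suc_leI)
  ultimately have "k \<le> dim (span (H ` {..k}) \<inter> ?Z)" by linarith
  then obtain L where L: "subspace L" "L \<subseteq> span (span (H ` {..k}) \<inter> ?Z)" "dim L = k"
    by (rule choose_subspace_of_subspace)
  have LZ: "L \<subseteq> span (H ` {..k})" "L \<subseteq> ?Z"
  proof -
    have closed: "span (span (H ` {..k}) \<inter> ?Z) = span (H ` {..k}) \<inter> ?Z"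
      using Z by (intro span_eq_iff[THEN iffD2] subspace_inter subspace_span)
    then show "L \<subseteq> span (H ` {..k})" "L \<subseteq> ?Z" using L(2)[unfolded closed] by blast+
  qed
  have admissible: "L \<in> {L :: (real ^ 'v) set. subspace L \<and> dim L = k \<and> (\<forall>c. vec c \<in> L \<longrightarrow> c = 0)}"
    using L LZ wvec total by force
  show ?thesis
    unfolding poincare_const_def
  proof (rule INF_lower2[OF admissible], rule SUP_least)
    fix \<phi> assume "\<phi> \<in> L - {0}"
    then have \<phi>: "\<phi> \<in> span (H ` {..k})" "w \<bullet> \<phi> = 0" using LZ by auto
    then obtain u where "\<phi> = (\<Sum>v\<in>H ` {..k}. u v *\<^sub>R v)"
      by (auto simp: span_finite)
    then have "\<phi> = (\<Sum>\<alpha>\<le>k. u (H \<alpha>) *\<^sub>R H \<alpha>)"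
      by (simp add: sum.reindex[OF inj])
    then have "\<phi> $ x = (\<Sum>\<alpha>\<le>k. u (H \<alpha>) * h \<alpha> x)" for x
      by (simp add: H_def)
    moreover have "wmean m \<phi> = 0" using \<phi>(2) by (simp add: wmean_def wdot)
    ultimately have "poincare_quotient p m \<phi> \<le> (1 / s) powr p"
      using poincare_quotient_le_of_disjoint_family[of m p s k B h \<phi> "\<lambda>\<alpha>. u (H \<alpha>)"] assms by blast
    then show "ereal (poincare_quotient p m \<phi>) \<le> ereal ((1 / s) powr p)" by simp
  qed
qed

text \<open>
  Real powers are well behaved only on nonnegative reals, so the sign of the constant matters when
  the \<open>p\<close>-th root is taken. For \<open>k = 0\<close> the only competitor is the zero space, whose supremum is
  \<open>- \<infinity>\<close>.
\<close>

lemma poincare_const_nonneg: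
  fixes m :: "'v::finite \<Rightarrow> 'v \<Rightarrow> real"
  assumes m_nonneg: "\<And>x y. 0 \<le> m x y" and "1 \<le> k"
  shows "0 \<le> poincare_const k p m"
  unfolding poincare_const_def
proof (rule INF_greatest)
  fix L :: "(real ^ 'v) set" assume "L \<in> {L. subspace L \<and> dim L = k \<and> (\<forall>c. vec c \<in> L \<longrightarrow> c = 0)}"
  then have "dim L \<noteq> 0" using \<open>1 \<le> k\<close> by auto
  then obtain \<phi> where "\<phi> \<in> L - {0}" using dim_eq_0[of L] by auto
  moreover have "0 \<le> ereal (poincare_quotient p m \<phi>)"
    unfolding poincare_quotient_def
    vmeas_def
  by (auto intro!: divide_nonneg_nonneg mult_nonneg_nonneg sum_nonneg simp: m_nonneg)
  ultimately show "0 \<le> (SUP \<phi>\<in>L - {0}. ereal (poincare_quotient p m \<phi>))"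
    by (meson SUP_upper2)
qed

section \<open>Several separated source sets\<close>

text \<open>
  All source sets share the slope \<open>1 / s\<close>, while the window in which a test function falls may differ
  from source to source. As the supports stay within \<open>\<rho> \<alpha> < D / 2\<close>, they are disjoint. If \<open>D\<close> is odd,
  an edge can still join two supports, but then the two heights add up to at most \<open>1 / s\<close>, just as
  for an edge inside one support.
\<close>

lemma poincare_const_le_of_separated_sources:
  fixes m :: "'v::finite \<Rightarrow> 'v \<Rightarrow> real" and \<rho> :: "nat \<Rightarrow> 'v \<Rightarrow> nat" and k D :: nat and s p :: real
  assumes m_nonneg: "\<And>x y. 0 \<le> m x y" and m_sym: "\<And>x y. m x y = m y x" and p: "1 \<le> p"
    and lip: "\<And>\<alpha> x y. \<alpha> \<le> k \<Longrightarrow> 0 < m x y \<Longrightarrow> \<rho> \<alpha> y \<le> Suc (\<rho> \<alpha> x)"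
    and sep: "\<And>\<alpha> \<beta> x. \<alpha> \<le> k \<Longrightarrow> \<beta> \<le> k \<Longrightarrow> \<alpha> \<noteq> \<beta> \<Longrightarrow> D \<le> \<rho> \<alpha> x + \<rho> \<beta> x"
    and A_pos: "\<And>\<alpha>. \<alpha> \<le> k \<Longrightarrow> 0 < smeas m {x. \<rho> \<alpha> x = 0}"
    and s: "0 < s" "s \<le> real D / 2"
    and growth: "\<And>\<alpha> j. \<alpha> \<le> k \<Longrightarrow> j < D \<Longrightarrow>
      smeas m {x. \<rho> \<alpha> x \<le> j} \<le> smeas m {x. \<rho> \<alpha> x = 0} * exp (real D / (2 * s) - 1)"
  shows "poincare_const k p m \<le> ereal ((1 / s) powr p)"
proof -
  have "\<forall>\<alpha>\<in>{..k}. \<exists>h B. B \<noteq> {} \<and> (\<forall>x. 0 \<le> h x) \<and> (\<forall>x\<in>B. h x = 1)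
    \<and> (\<forall>x. h x \<le> max 0 ((real D / 2 - real (\<rho> \<alpha> x)) / s))
    \<and> (\<forall>x y. 0 < m x y \<longrightarrow> \<bar>h x - h y\<bar> \<le> 1 / s)
    \<and> s * (\<Sum>x\<in>UNIV. \<Sum>y\<in>UNIV. \<bar>h x - h y\<bar> * m x y) \<le> 2 * smeas m B"
    by (intro ballI cutoff_function_exists) (use m_nonneg m_sym lip A_pos s growth in auto)
  then obtain h B where hB: "\<forall>\<alpha>\<in>{..k}. B \<alpha> \<noteq> {} \<and> (\<forall>x. 0 \<le> h \<alpha> x) \<and> (\<forall>x\<in>B \<alpha>. h \<alpha> x = 1)
    \<and> (\<forall>x. h \<alpha> x \<le> max 0 ((real D / 2 - real (\<rho> \<alpha> x)) / s))
    \<and> (\<forall>x y. 0 < m x y \<longrightarrow> \<bar>h \<alpha> x - h \<alpha> y\<bar> \<le> 1 / s)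
    \<and> s * (\<Sum>x\<in>UNIV. \<Sum>y\<in>UNIV. \<bar>h \<alpha> x - h \<alpha> y\<bar> * m x y) \<le> 2 * smeas m (B \<alpha>)"
    unfolding bchoice_iff by (elim exE) (rule that)
  have B_ne: "B \<alpha> \<noteq> {}" and h_nonneg: "0 \<le> h \<alpha> x" and h_one: "x \<in> B \<alpha> \<Longrightarrow> h \<alpha> x = 1"
    and height: "h \<alpha> x \<le> max 0 ((real D / 2 - real (\<rho> \<alpha> x)) / s)"
    and slope: "0 < m x y \<Longrightarrow> \<bar>h \<alpha> x - h \<alpha> y\<bar> \<le> 1 / s"
    and energy: "s * (\<Sum>x\<in>UNIV. \<Sum>y\<in>UNIV. \<bar>h \<alpha> x - h \<alpha> y\<bar> * m x y) \<le> 2 * smeas m (B \<alpha>)"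
    if "\<alpha> \<le> k" for \<alpha> x y
    using bspec[OF hB, of \<alpha>] that by simp_all
  have height': "s * h \<alpha> x \<le> real D / 2 - real (\<rho> \<alpha> x)" if "\<alpha> \<le> k" "h \<alpha> x \<noteq> 0" for \<alpha> x
  proof -
    have "0 < h \<alpha> x" using h_nonneg[of \<alpha> x] that by simp
    then have "h \<alpha> x \<le> (real D / 2 - real (\<rho> \<alpha> x)) / s" using height[of \<alpha> x] that by (simp add: max_def split: if_splits)
    then show ?thesis using s by (simp add: field_simps)
  qed
  have disj: "h \<alpha> x = 0 \<or> h \<beta> x = 0" if "\<alpha> \<le> k" "\<beta> \<le> k" "\<alpha> \<noteq> \<beta>" for \<alpha> \<beta> x
  proof (rule ccontr)
    assume "\<not> ?thesis"
    then have nz: "h \<alpha> x \<noteq> 0" "h \<beta> x \<noteq> 0" by auto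
    then have "0 < s * h \<alpha> x" "0 < s * h \<beta> x"
      using h_nonneg[of \<alpha> x] h_nonneg[of \<beta> x] that s by auto
    moreover have "real D \<le> real (\<rho> \<alpha> x) + real (\<rho> \<beta> x)" using sep[OF that, of x] by linarith
    ultimately show False
      using height'[OF that(1) nz(1)] height'[OF that(2) nz(2)] by linarith
  qed
  have total_slope: "(\<Sum>\<alpha>\<le>k. \<bar>h \<alpha> x - h \<alpha> y\<bar>) \<le> 1 / s" if mxy: "0 < m x y" for x y
  proof -
    \<comment> \<open>Each vertex lies in at most one support.\<close>
    have *: "\<exists>\<alpha>\<le>k. \<forall>\<gamma>\<le>k. \<gamma> \<noteq> \<alpha> \<longrightarrow> h \<gamma> z = 0" for z
      using disj by (cases "\<exists>\<alpha>\<le>k. h \<alpha> z \<noteq> 0") blast+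
    obtain \<alpha> where \<alpha>: "\<alpha> \<le> k" "\<And>\<gamma>. \<gamma> \<le> k \<Longrightarrow> \<gamma> \<noteq> \<alpha> \<Longrightarrow> h \<gamma> x = 0" using *[of x] by blast
    obtain \<beta> where \<beta>: "\<beta> \<le> k" "\<And>\<gamma>. \<gamma> \<le> k \<Longrightarrow> \<gamma> \<noteq> \<beta> \<Longrightarrow> h \<gamma> y = 0" using *[of y] by blast
    have "(\<Sum>\<gamma>\<le>k. \<bar>h \<gamma> x - h \<gamma> y\<bar>) = (\<Sum>\<gamma>\<in>{\<alpha>, \<beta>}. \<bar>h \<gamma> x - h \<gamma> y\<bar>)"
      using \<alpha> \<beta> by (intro sum.mono_neutral_right) auto
    also have "\<dots> \<le> 1 / s"
    proof (cases "\<alpha> = \<beta> \<or> h \<alpha> x = 0 \<or> h \<beta> y = 0")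
      case True
      then show ?thesis
        using slope[OF \<alpha>(1) mxy] slope[OF \<beta>(1) mxy] \<alpha>(2)[OF \<beta>(1)] \<beta>(2)[OF \<alpha>(1)]
        by (cases "\<alpha> = \<beta>") auto
    next
      case False
      then have nz: "h \<alpha> x \<noteq> 0" "h \<beta> y \<noteq> 0" "\<alpha> \<noteq> \<beta>" by auto
      have "real D \<le> real (\<rho> \<alpha> x) + real (\<rho> \<beta> y) + 1"
        using sep[OF \<alpha>(1) \<beta>(1) nz(3), of x] lip[OF \<beta>(1), of y x] mxy m_sym[of x y] by auto
      then have "s * (h \<alpha> x + h \<beta> y) \<le> 1"
        using height'[OF \<alpha>(1) nz(1)] height'[OF \<beta>(1) nz(2)] by (simp add: distrib_left)
      then have "h \<alpha> x + h \<beta> y \<le> 1 / s" using s by (simp add: field_simps)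
      then show ?thesis
        using nz \<alpha>(2)[OF \<beta>(1)] \<beta>(2)[OF \<alpha>(1)] h_nonneg[OF \<alpha>(1), of x] h_nonneg[OF \<beta>(1), of y] by simp
    qed
    finally show ?thesis .
  qed
  have "0 < smeas m UNIV"
    using A_pos[of 0] smeas_mono[of m "{x. \<rho> 0 x = 0}" UNIV] m_nonneg by simp
  then show ?thesis
    using poincare_const_le_of_disjoint_family[of m p s k B h]
      m_nonneg p s(1) B_ne h_one disj total_slope energy by blast
qed

text \<open>
  A ball of radius less than the separation meets no other source set.
\<close>

lemma smeas_ball_le_rest:
  fixes m :: "'v::finite \<Rightarrow> 'v \<Rightarrow> real" and \<rho> :: "nat \<Rightarrow> 'v \<Rightarrow> nat" and k D :: nat
  assumes m_nonneg: "\<And>x y. 0 \<le> m x y"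
    and sep: "\<And>\<alpha> \<beta> x. \<alpha> \<le> k \<Longrightarrow> \<beta> \<le> k \<Longrightarrow> \<alpha> \<noteq> \<beta> \<Longrightarrow> D \<le> \<rho> \<alpha> x + \<rho> \<beta> x"
    and "\<alpha> \<le> k" "j < D"
  shows "smeas m {x. \<rho> \<alpha> x \<le> j} \<le> smeas m UNIV - (\<Sum>\<beta>\<in>{0..k} - {\<alpha>}. smeas m {x. \<rho> \<beta> x = 0})"
proof -
  let ?I = "{0..k} - {\<alpha>}" and ?A = "\<lambda>\<beta>. {x. \<rho> \<beta> x = 0}"
  have "(\<Sum>\<beta>\<in>?I. smeas m (?A \<beta>)) = smeas m (\<Union>\<beta>\<in>?I. ?A \<beta>)"
    unfolding smeas_def
  proof (rule sum.UNION_disjoint[symmetric])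
    show "\<forall>\<beta>\<in>?I. \<forall>\<gamma>\<in>?I. \<beta> \<noteq> \<gamma> \<longrightarrow> ?A \<beta> \<inter> ?A \<gamma> = {}"
    proof (intro ballI impI equals0I)
      fix \<beta> \<gamma> x assume *: "\<beta> \<in> ?I" "\<gamma> \<in> ?I" "\<beta> \<noteq> \<gamma>" "x \<in> ?A \<beta> \<inter> ?A \<gamma>"
      then show False using sep[of \<beta> \<gamma> x] \<open>j < D\<close> by simp
    qed
  qed auto
  moreover have "{x. \<rho> \<alpha> x \<le> j} \<inter> (\<Union>\<beta>\<in>?I. ?A \<beta>) = {}"
  proof (intro equals0I)
    fix x assume "x \<in> {x. \<rho> \<alpha> x \<le> j} \<inter> (\<Union>\<beta>\<in>?I. ?A \<beta>)"
    then obtain \<beta> where "\<rho> \<alpha> x \<le> j" "\<beta> \<le> k" "\<beta> \<noteq> \<alpha>" "\<rho> \<beta> x = 0"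
      by (elim IntE UN_E DiffE) simp
    then show False using sep[of \<alpha> \<beta> x] assms by simp
  qed
  then have "smeas m {x. \<rho> \<alpha> x \<le> j} + smeas m (\<Union>\<beta>\<in>?I. ?A \<beta>)
      = smeas m ({x. \<rho> \<alpha> x \<le> j} \<union> (\<Union>\<beta>\<in>?I. ?A \<beta>))"
    unfolding smeas_def by (intro sum.union_disjoint[symmetric]) auto
  then have "smeas m {x. \<rho> \<alpha> x \<le> j} + smeas m (\<Union>\<beta>\<in>?I. ?A \<beta>) \<le> smeas m UNIV"
    using smeas_mono[of m "{x. \<rho> \<alpha> x \<le> j} \<union> (\<Union>\<beta>\<in>?I. ?A \<beta>)" UNIV] m_nonneg by simp
  ultimately show ?thesis by simp
qed

section \<open>The graph distance\<close>

context weighted_graph begin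

lemma relpow_iff_awalk: "(x, y) \<in> parcs G ^^ n \<longleftrightarrow> (\<exists>q. awalk x q y \<and> length q = n)"
proof (induction n arbitrary: x)
  case 0
  show ?case by (auto simp: awalk_Nil_iff verts_UNIV)
next
  case (Suc n)
  have "(x, y) \<in> parcs G ^^ Suc n \<longleftrightarrow> (\<exists>z. (x, z) \<in> parcs G \<and> (z, y) \<in> parcs G ^^ n)"
    by (metis relpow_Suc_D2 relpow_Suc_I2)
  also have "\<dots> \<longleftrightarrow> (\<exists>z q. (x, z) \<in> parcs G \<and> awalk z q y \<and> length q = n)"
    using Suc.IH by blast
  also have "\<dots> \<longleftrightarrow> (\<exists>q. awalk x q y \<and> length q = Suc n)"
  proof (intro iffI; elim exE conjE)
    fix z q assume "(x, z) \<in> parcs G" "awalk z q y" "length q = n"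
    then show "\<exists>q. awalk x q y \<and> length q = Suc n"
      by (intro exI[of _ "(x, z) # q"]) (simp add: awalk_Cons_iff)
  next
    fix q assume q: "awalk x q y" "length q = Suc n"
    then obtain e r where "q = e # r" by (cases q) auto
    with q show "\<exists>z q. (x, z) \<in> parcs G \<and> awalk z q y \<and> length q = n"
      by (intro exI[of _ "snd e"] exI[of _ r]) (auto simp: awalk_Cons_iff)
  qed
  finally show ?case .
qed

lemma relpow_exists: "\<exists>n. (x, y) \<in> parcs G ^^ n"
proof -
  have "strongly_connected (with_proj G)"
    using symmetric_connected_imp_strongly_connected[OF pair_sym_arcs connected_graph] .
  then have "x \<rightarrow>\<^sup>*\<^bsub>with_proj G\<^esub> y" by (auto simp: strongly_connected_def verts_UNIV)
  then show ?thesis unfolding relpow_iff_awalk reachable_awalk by blast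
qed

lemma relpow_sym: "(x, y) \<in> parcs G ^^ n \<Longrightarrow> (y, x) \<in> parcs G ^^ n"
proof (induction n arbitrary: x)
  case (Suc n)
  then obtain z where "(x, z) \<in> parcs G" "(z, y) \<in> parcs G ^^ n" by (meson relpow_Suc_D2)
  moreover from this have "(z, x) \<in> parcs G" using weight_pos_iff weight_sym by metis
  ultimately show ?case using Suc.IH by (metis relpow_Suc_I)
qed simp

lemma gdist_eq: "gdist G x y = (INF q\<in>{q. awalk x q y}. ereal (real (length q)))"
proof -
  have "awalk_cost (\<lambda>_. 1) q = real (length q)" for q :: "('v \<times> 'v) list"
    by (induction q) (auto simp: awalk_cost_def)
  then show ?thesis by (simp add: gdist_def \<mu>_def)
qed

lemma gdist_le: "(x, y) \<in> parcs G ^^ n \<Longrightarrow> gdist G x y \<le> ereal (real n)"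
  unfolding gdist_eq relpow_iff_awalk by (elim exE conjE) (rule INF_lower2, auto)

text \<open>
  Costs of walks are natural numbers, so the infimum defining the distance is attained, and by
  connectedness it is finite.
\<close>

lemma gdist_nat: "\<exists>n. gdist G x y = ereal (real n)"
proof -
  define n where "n = (LEAST n. (x, y) \<in> parcs G ^^ n)"
  have n: "(x, y) \<in> parcs G ^^ n" unfolding n_def by (rule LeastI_ex) (rule relpow_exists)
  have "ereal (real n) \<le> gdist G x y"
    unfolding gdist_eq
  proof (rule INF_greatest)
    fix q assume "q \<in> {q. awalk x q y}"
    then have "(x, y) \<in> parcs G ^^ length q" unfolding relpow_iff_awalk by blast
    then show "ereal (real n) \<le> ereal (real (length q))" unfolding n_def by (simp add: Least_le)
  qed
  with gdist_le[OF n] show ?thesis by (intro exI[of _ n]) simp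
qed

text \<open>
  All minima and infima in the separation are attained. Of its value only two facts are used: it is
  a natural number \<open>D\<close>, and every walk between two different sets has length at least \<open>D\<close>.
\<close>

lemma separation_nat:
  assumes k: "1 \<le> k" and ne: "\<And>\<alpha>. \<alpha> \<le> k \<Longrightarrow> A \<alpha> \<noteq> {}"
  obtains D where "separation G k A = ereal (real D)"
    and "\<And>\<alpha> \<beta> a b n. \<lbrakk>\<alpha> \<le> k; \<beta> \<le> k; \<alpha> \<noteq> \<beta>; a \<in> A \<alpha>; b \<in> A \<beta>; (a, b) \<in> parcs G ^^ n\<rbrakk> \<Longrightarrow> D \<le> n"
proof -
  let ?S = "{gsetdist G (A \<alpha>) (A \<beta>) | \<alpha> \<beta>. \<alpha> \<le> k \<and> \<beta> \<le> k \<and> \<alpha> \<noteq> \<beta>}"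
  let ?d = "\<lambda>\<alpha> \<beta>. {gdist G x y | x y. x \<in> A \<alpha> \<and> y \<in> A \<beta>}"
  have fin: "finite (?d \<alpha> \<beta>)" for \<alpha> \<beta>
    by (rule finite_subset[of _ "(\<lambda>(x, y). gdist G x y) ` UNIV"]) auto
  have "finite ?S"
    by (rule finite_subset[of _ "(\<lambda>(\<alpha>, \<beta>). gsetdist G (A \<alpha>) (A \<beta>)) ` ({..k} \<times> {..k})"]) auto
  moreover have "gsetdist G (A 0) (A 1) \<in> ?S"
    by (intro CollectI exI[of _ 0] exI[of _ 1]) (use k in auto)
  ultimately have sep: "separation G k A \<in> ?S" "\<And>z. z \<in> ?S \<Longrightarrow> separation G k A \<le> z"
    unfolding separation_def using Min_in[of ?S] Min_le[of ?S] by blast+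
  then obtain \<alpha> \<beta> where *: "\<alpha> \<le> k" "\<beta> \<le> k" "separation G k A = Inf (?d \<alpha> \<beta>)"
    unfolding gsetdist_def by blast
  have ne': "?d \<alpha> \<beta> \<noteq> {}" using ne[OF *(1)] ne[OF *(2)] by blast
  then have "Inf (?d \<alpha> \<beta>) \<in> ?d \<alpha> \<beta>" using Min_in[OF fin ne'] cInf_eq_Min[OF fin ne'] by simp
  then obtain D where D: "separation G k A = ereal (real D)"
    using gdist_nat *(3) by (smt (verit) mem_Collect_eq)
  moreover have "D \<le> n"
    if "\<alpha> \<le> k" "\<beta> \<le> k" "\<alpha> \<noteq> \<beta>" "a \<in> A \<alpha>" "b \<in> A \<beta>" "(a, b) \<in> parcs G ^^ n" for \<alpha> \<beta> a b n
  proof -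
    have "separation G k A \<le> gsetdist G (A \<alpha>) (A \<beta>)" using that by (intro sep) blast
    also have "\<dots> \<le> gdist G a b" unfolding gsetdist_def using that by (intro Inf_lower) blast
    also have "\<dots> \<le> ereal (real n)" using that by (intro gdist_le)
    finally show ?thesis by (simp add: D)
  qed
  ultimately show thesis by (rule that)
qed

definition hops_from :: "'v set \<Rightarrow> 'v \<Rightarrow> nat" where
  "hops_from A x = (LEAST n. \<exists>a\<in>A. (a, x) \<in> parcs G ^^ n)"

lemma hops_from_attained:
  assumes "A \<noteq> {}"
  obtains a where "a \<in> A" "(a, x) \<in> parcs G ^^ hops_from A x"
proof -
  have "\<exists>n. \<exists>a\<in>A. (a, x) \<in> parcs G ^^ n" using assms relpow_exists by blast
  then have "\<exists>a\<in>A. (a, x) \<in> parcs G ^^ hops_from A x" unfolding hops_from_def by (rule LeastI_ex)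
  then show thesis using that by blast
qed

lemma hops_from_le: "a \<in> A \<Longrightarrow> (a, x) \<in> parcs G ^^ n \<Longrightarrow> hops_from A x \<le> n"
  unfolding hops_from_def by (rule Least_le) blast

lemma hops_from_eq_0_iff: "A \<noteq> {} \<Longrightarrow> hops_from A x = 0 \<longleftrightarrow> x \<in> A"
  by (metis hops_from_attained hops_from_le le_zero_eq relpow_0_E relpow_0_I)

lemma hops_from_edge: "A \<noteq> {} \<Longrightarrow> 0 < m x y \<Longrightarrow> hops_from A y \<le> Suc (hops_from A x)"
  by (metis hops_from_attained hops_from_le relpow_Suc_I weight_pos_iff)

lemma hops_from_add_ge:
  assumes "A \<noteq> {}" "B \<noteq> {}"
    and far: "\<And>a b n. a \<in> A \<Longrightarrow> b \<in> B \<Longrightarrow> (a, b) \<in> parcs G ^^ n \<Longrightarrow> D \<le> n"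
  shows "D \<le> hops_from A x + hops_from B x"
proof -
  obtain a where a: "a \<in> A" "(a, x) \<in> parcs G ^^ hops_from A x"
    by (rule hops_from_attained[OF \<open>A \<noteq> {}\<close>])
  obtain b where b: "b \<in> B" "(b, x) \<in> parcs G ^^ hops_from B x"
    by (rule hops_from_attained[OF \<open>B \<noteq> {}\<close>])
  have "(a, b) \<in> parcs G ^^ (hops_from A x + hops_from B x)"
    using a(2) relpow_sym[OF b(2)] by (auto simp: relpow_add)
  then show ?thesis by (rule far[OF a(1) b(1)])
qed

end

section \<open>The Poincare constant and the separation of sets\<close>

theorem theorem8p5:
  fixes G :: "('v::finite) pair_pre_digraph"
    and m :: "'v \<Rightarrow> 'v \<Rightarrow> real"
    and p :: real
    and k :: nat
    and A :: "nat \<Rightarrow> 'v set"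
  assumes "weighted_graph G m"
    and "1 \<le> p"
    and "1 \<le> k" and "k \<le> card (pverts G) - 1"
  shows "ereal_powr (poincare_const k p m) (1 / p) \<le>
    (if separation G k A = 0 \<or> (\<exists>\<alpha>\<le>k. smeas m (A \<alpha>) = 0) then \<infinity>
     else 2 / separation G k A *
       ereal (Max ((\<lambda>\<alpha>. ln (exp 1 * (smeas m (pverts G) - (\<Sum>\<beta>\<in>{0..k} - {\<alpha>}. smeas m (A \<beta>)))
                            / smeas m (A \<alpha>))) ` {0..k})))"
proof (cases "separation G k A = 0 \<or> (\<exists>\<alpha>\<le>k. smeas m (A \<alpha>) = 0)")
  case False
  interpret weighted_graph G m by fact
  have A_pos: "0 < smeas m (A \<alpha>)" if "\<alpha> \<le> k" for \<alpha>
  proof -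
    have "0 \<le> smeas m (A \<alpha>)"
      unfolding smeas_def vmeas_def by (intro sum_nonneg) (simp add: weight_nonneg)
    then show ?thesis using False that by (auto simp: less_le)
  qed
  have A_ne: "A \<alpha> \<noteq> {}" if "\<alpha> \<le> k" for \<alpha> using A_pos[OF that] by (auto simp: smeas_def)
  obtain D where D: "separation G k A = ereal (real D)"
    and far: "\<And>\<alpha> \<beta> a b n. \<lbrakk>\<alpha> \<le> k; \<beta> \<le> k; \<alpha> \<noteq> \<beta>; a \<in> A \<alpha>; b \<in> A \<beta>; (a, b) \<in> parcs G ^^ n\<rbrakk> \<Longrightarrow> D \<le> n"
    by (rule separation_nat[OF \<open>1 \<le> k\<close>, of A]) (use A_ne in blast, rule that)
  have D1: "0 < D" using False D by (cases D) auto
  define \<rho> where "\<rho> \<alpha> = hops_from (A \<alpha>)" for \<alpha>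
  have lip: "\<rho> \<alpha> y \<le> Suc (\<rho> \<alpha> x)" if "\<alpha> \<le> k" "0 < m x y" for \<alpha> x y
    unfolding \<rho>_def using hops_from_edge[OF A_ne[OF that(1)] that(2)] .
  have zero: "{x. \<rho> \<alpha> x = 0} = A \<alpha>" if "\<alpha> \<le> k" for \<alpha>
    unfolding \<rho>_def using hops_from_eq_0_iff[OF A_ne[OF that]] by simp
  have sep: "D \<le> \<rho> \<alpha> x + \<rho> \<beta> x" if "\<alpha> \<le> k" "\<beta> \<le> k" "\<alpha> \<noteq> \<beta>" for \<alpha> \<beta> x
    unfolding \<rho>_def by (rule hops_from_add_ge[OF A_ne[OF that(1)] A_ne[OF that(2)] far[OF that]])
  define M where "M \<alpha> = smeas m UNIV - (\<Sum>\<beta>\<in>{0..k} - {\<alpha>}. smeas m (A \<beta>))" for \<alpha>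
  define \<Lambda> where "\<Lambda> = Max ((\<lambda>\<alpha>. ln (exp 1 * M \<alpha> / smeas m (A \<alpha>))) ` {0..k})"
  have ball_le_M: "smeas m {x. \<rho> \<alpha> x \<le> j} \<le> M \<alpha>" if "\<alpha> \<le> k" "j < D" for \<alpha> j
  proof -
    have "(\<Sum>\<beta>\<in>{0..k} - {\<alpha>}. smeas m {x. \<rho> \<beta> x = 0}) = (\<Sum>\<beta>\<in>{0..k} - {\<alpha>}. smeas m (A \<beta>))"
      by (rule sum.cong) (auto simp: zero)
    then show ?thesis
      using smeas_ball_le_rest[of m k D \<rho> \<alpha> j] weight_nonneg sep that by (simp add: M_def)
  qed
  have A_le_M: "smeas m (A \<alpha>) \<le> M \<alpha>" if "\<alpha> \<le> k" for \<alpha>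
    using ball_le_M[OF that D1] zero[OF that] by simp
  have ln_le: "1 + ln (M \<alpha> / smeas m (A \<alpha>)) \<le> \<Lambda>" if "\<alpha> \<le> k" for \<alpha>
  proof -
    have "0 < M \<alpha> / smeas m (A \<alpha>)" using A_pos[OF that] A_le_M[OF that] by auto
    then have "ln (exp 1 * (M \<alpha> / smeas m (A \<alpha>))) = 1 + ln (M \<alpha> / smeas m (A \<alpha>))"
      by (subst ln_mult_pos) auto
    moreover have "ln (exp 1 * M \<alpha> / smeas m (A \<alpha>)) \<le> \<Lambda>"
      unfolding \<Lambda>_def using that by (intro Max_ge imageI) auto
    ultimately show ?thesis by simp
  qed
  have \<Lambda>1: "1 \<le> \<Lambda>"
  proof -
    have "0 \<le> ln (M 0 / smeas m (A 0))" using A_pos[of 0] A_le_M[of 0] by simp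
    then show ?thesis using ln_le[of 0] by simp
  qed
  \<comment> \<open>The slope is chosen to make \<open>1 / s\<close> the right-hand side of the
    theorem.\<close>
  define s where "s = real D / (2 * \<Lambda>)"
  have s: "0 < s" "s \<le> real D / 2" using D1 \<Lambda>1 by (auto simp: s_def field_simps)
  have growth: "smeas m {x. \<rho> \<alpha> x \<le> j} \<le> smeas m {x. \<rho> \<alpha> x = 0} * exp (real D / (2 * s) - 1)"
    if "\<alpha> \<le> k" "j < D" for \<alpha> j
  proof -
    have pos: "0 < M \<alpha> / smeas m (A \<alpha>)" using A_pos[of \<alpha>] A_le_M[of \<alpha>] that by auto
    have "M \<alpha> / smeas m (A \<alpha>) = exp (ln (M \<alpha> / smeas m (A \<alpha>)))" using pos by simp
    also have "\<dots> \<le> exp (\<Lambda> - 1)" using ln_le[of \<alpha>] that by simp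
    also have "\<Lambda> = real D / (2 * s)" using D1 \<Lambda>1 by (simp add: s_def)
    finally show ?thesis
      using ball_le_M[OF that] A_pos[of \<alpha>] that zero[of \<alpha>]
      by (simp add: field_simps)
  qed
  have upper: "poincare_const k p m \<le> ereal ((1 / s) powr p)"
    by (rule poincare_const_le_of_separated_sources[of m p k \<rho> D s])
      (use weight_nonneg weight_sym \<open>1 \<le> p\<close> lip sep A_pos zero s growth in auto)
  have lower: "0 \<le> poincare_const k p m"
    using weight_nonneg \<open>1 \<le> k\<close> by (rule poincare_const_nonneg)
  obtain \<nu> where \<nu>: "poincare_const k p m = ereal \<nu>" "0 \<le> \<nu>" "\<nu> \<le> (1 / s) powr p"
    using upper lower by (cases "poincare_const k p m") auto
  have "\<nu> powr (1 / p) \<le> ((1 / s) powr p) powr (1 / p)"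
    using \<nu> \<open>1 \<le> p\<close> by (intro powr_mono2) auto
  also have "\<dots> = 1 / s" using \<open>1 \<le> p\<close> s by (simp add: powr_powr)
  also have "\<dots> = 2 / real D * \<Lambda>" using D1 \<Lambda>1 by (simp add: s_def)
  finally have "ereal_powr (poincare_const k p m) (1 / p) \<le> ereal (2 / real D * \<Lambda>)"
    by (simp add: \<nu> ereal_powr_def)
  also have "ereal (2 / real D * \<Lambda>) = 2 / separation G k A * ereal \<Lambda>"
    unfolding D numeral_eq_ereal using D1 by simp
  finally show ?thesis
    using False by (simp add: \<Lambda>_def M_def verts_UNIV)
qed simp

end
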